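(* Let $1\le n\le p$, let $K\in\mathbb{N}$, and let $\mathscr{S}: M_{n\times p}\to\mathbb{C}^m$ be a surjective linear map. Consider the IRLS-M algorithm (defined in the context) with parameters $\gamma=1/n$ and $K$. Then, for each $\mathscr{M}\in\mathbb{C}^m$, the sequences $(X^\ell)_{\ell\ge1}$ and $(\varepsilon_\ell)_{\ell}$ produced by the algorithm from $\mathscr{S}$ and $\mathscr{M}$ have the following properties: (i) Assume that $\mathscr{S}$ satisfies the strong rank null space property of order $K$ (with some constant $\eta\in(0,1)$). If $\lim_{\ell\to\infty}\varepsilon_\ell=0$, then $(X^\ell)_{\ell}$ converges to a matrix $\bar X$ of rank at most $K$ with $\mathscr{S}(\bar X)=\mathscr{M}$; in this case, $\bar X$ is also the unique minimizer of $\|X\|_*$ subject to $\mathscr{S}(X)=\mathscr{M}$. (ii) If $\lim_{\ell\to\infty}\varepsilon_\ell=\varepsilon>0$, then every subsequence of $(X^\ell)_\ell$ has a convergent subsequence. Each accumulation point of $(X^\ell)_{\ell}$ is a minimizer $\bar X$ of the functional $\mathcal{J}_\varepsilon$ subject to $\mathscr{S}(\bar X)=\mathscr{M}$. In particular, if this minimizer is unique, then the full sequence $(X^\ell)_\ell$ converges to it. If, in addition, $K>2$ and $\mathscr{S}$ satisfies the strong rank null space property of order $K$ with constant $\eta\in(0,1)$, $\eta<1-\frac{2}{K-2}$, then each accumulation point $\bar X$ of $(X^\ell)_\ell$ satisfies, for any matrix $X\in M_{n\times p}$ such that $\mathscr{S}(X)=\mathscr{M}$ and for every integer $k\ge 0$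 with $k<K-\frac{2\eta}{1-\eta}$, $$\|X-\bar X\|_*\le\Lambda\,\rho_k(X)_*,\qquad \Lambda:=\frac{4(1+\eta)^2}{(1-\eta)^2\big((K-k)(1-\eta)-2\eta\big)}+\frac{2(1+\eta)}{1-\eta}.$$ (iii) In particular, if $K>2$, if $\mathscr{S}$ satisfies the strong rank null space property of order $K$ with constant $\eta\in(0,1)$, $\eta<1-\frac{2}{K-2}$, and if there exists a matrix $X$ of rank at most $k$ satisfying $\mathscr{S}(X)=\mathscr{M}$, where $k$ is an integer with $0\le k<K-\frac{2\eta}{1-\eta}$, then necessarily $\lim_{\ell\to\infty}\varepsilon_\ell=0$.
   Context: $M_{n\times p}$ is the space of complex $n\times p$ matrices, with inner product $\langle X,Y\rangle=\operatorname{Tr}(XY^* )$ and Frobenius norm $\|\cdot\|_F$. For $X\in M_{n\times p}$, $n\le p$, $\sigma_1(X)\ge\dots\ge\sigma_n(X)\ge0$ are its singular values (with $\sigma_i(X)=0$ for $i>n$), and $\|X\|_*=\sum_{i=1}^n\sigma_i(X)$ is the nuclear norm. The best $k$-rank approximation error is $\rho_k(X)_*:=\min_{\operatorname{rank}(Z)\le k}\|X-Z\|_*$. IRLS-M algorithm (input: linear map $\mathscr{S}:M_{n\times p}\to\mathbb{C}^m$, data $\mathscr{M}\in\mathbb{C}^m$, parameters $K\in\mathbb{N}$, $\gamma>0$): Set $W^0=I\in M_{n\times n}$, $\varepsilon_0=1$. For $\ell=1,2,\dots$ define $$X^\ell:=\arg\min_{\mathscr{S}(X)=\mathscr{M}}\|(W^{\ell-1})^{1/2}X\|_F^2,\qquad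 \varepsilon_\ell:=\min\{\varepsilon_{\ell-1},\gamma\,\sigma_{K+1}(X^\ell)\}.$$ If $\varepsilon_\ell=0$ the algorithm stops, and one sets $X^j:=X^\ell$ (and $\varepsilon_j:=0$) for $j>\ell$. Otherwise, write $X^\ell(X^\ell)^*=U^\ell(\Sigma^\ell)^2(U^\ell)^*$ with $U^\ell\in M_{n\times n}$ unitary and $\Sigma^\ell=\operatorname{diag}(\sigma_1(X^\ell),\dots,\sigma_n(X^\ell))$, and set $$W^\ell:=U^\ell\,\operatorname{diag}\big(\max\{\sigma_j(X^\ell),\varepsilon_\ell\}\big)^{-1}(U^\ell)^*.$$ Strong rank null space property (SRNSP) of order $k$ with constant $\eta\in(0,1)$: for all $X\in\ker\mathscr{S}\setminus\{0\}$ and all decompositions $X=X_1+X_2$ with $\operatorname{rank}(X_1)\le k$, there exists another decomposition $X=H_1+H_2$ such that $\operatorname{rank}(H_1)\le 2k$, $\langle H_1,H_2\rangle=0$, $X_1H_2^*=0$, $X_1^*H_2=0$, and $\|H_1\|_*\le\eta\|H_2\|_*$. For $\varepsilon>0$, the functional $\mathcal{J}_\varepsilon$ on $M_{n\times p}$ is $\mathcal{J}_\varepsilon(X)=\sum_{i=1}^n j^\varepsilon(\sigma_i(X))$, where $j^\varepsilon(u)=|u|$ if $|u|\ge\varepsilon$ and $j^\varepsilon(u)=\frac{u^2+\varepsilon^2}{2\varepsilon}$ if $|u|<\varepsilon$. *)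

theory Defs
  imports "HOL-Analysis.Analysis" "HOL-Computational_Algebra.Polynomial" "HOL-Library.Multiset"
begin

text \<open>
  The space of complex matrices with n rows and p columns is the type \<open>complex^'p^'n\<close>.
  Its library norm is the Frobenius norm and its library topology the Euclidean one; the
  library's \<open>rank\<close> is the rank over the field of complex numbers.
\<close>

definition cscale :: "complex \<Rightarrow> complex^'p^'n \<Rightarrow> complex^'p^'n" where
  "cscale c X = (\<chi> i j. c * X $ i $ j)"

definition cadj :: "complex^'p^'n \<Rightarrow> complex^'n^'p" where
  "cadj X = (\<chi> i j. cnj (X $ j $ i))"

definition frob_inner :: "complex^'p^'n \<Rightarrow> complex^'p^'n \<Rightarrow> complex" where
  "frob_inner X Y = trace (X ** cadj Y)"

definition unitary_mat :: "complex^'n^'n \<Rightarrow> bool" where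
  "unitary_mat U \<longleftrightarrow> U ** cadj U = mat 1 \<and> cadj U ** U = mat 1"

definition diag_mat :: "('n \<Rightarrow> real) \<Rightarrow> complex^'n^'n" where
  "diag_mat d = (\<chi> i j. if i = j then complex_of_real (d i) else 0)"

definition psd_mat :: "complex^'n^'n \<Rightarrow> bool" where
  "psd_mat A \<longleftrightarrow> cadj A = A \<and> (\<forall>x. 0 \<le> Re (\<Sum>i\<in>UNIV. cnj (x $ i) * (A *v x) $ i))"

definition psd_sqrt :: "complex^'n^'n \<Rightarrow> complex^'n^'n" where
  "psd_sqrt A = (THE B. psd_mat B \<and> B ** B = A)"

definition charpoly :: "complex^'n^'n \<Rightarrow> complex poly" where
  "charpoly A = det (\<chi> i j. (if i = j then [:0, 1:] else 0) - [:A $ i $ j:])"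

text \<open>
  The singular values are the square roots of the eigenvalues of \<open>X X\<^sup>*\<close> (which are real and
  nonnegative, so that \<open>Re\<close> loses nothing), repeated according to multiplicity. There are
  exactly \<open>CARD('n)\<close> of them. In \<open>sing_val X i\<close> the index starts at 1, and the value is 0
  for indices beyond \<open>CARD('n)\<close>.
\<close>

definition sing_vals :: "complex^'p^'n \<Rightarrow> real list" where
  "sing_vals X =
     rev (sorted_list_of_multiset (image_mset (\<lambda>z. sqrt (Re z)) (proots (charpoly (X ** cadj X)))))"

definition sing_val :: "complex^'p^'n \<Rightarrow> nat \<Rightarrow> real" where
  "sing_val X i = (if 1 \<le> i \<and> i \<le> CARD('n) then sing_vals X ! (i - 1) else 0)"

definition nuclear_norm :: "complex^'p^'n \<Rightarrow> real" where
  "nuclear_norm X = (\<Sum>i=1..CARD('n). sing_val X i)"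

text \<open>The infimum below is attained.\<close>

definition best_rank_error :: "nat \<Rightarrow> complex^'p^'n \<Rightarrow> real" where
  "best_rank_error k X = Inf {nuclear_norm (X - Z) | Z. rank Z \<le> k}"

definition srnsp :: "(complex^'p^'n \<Rightarrow> complex^'m) \<Rightarrow> nat \<Rightarrow> real \<Rightarrow> bool" where
  "srnsp S k \<eta> \<longleftrightarrow> 0 < \<eta> \<and> \<eta> < 1 \<and>
     (\<forall>X. S X = 0 \<longrightarrow> X \<noteq> 0 \<longrightarrow>
       (\<forall>X1 X2. X = X1 + X2 \<longrightarrow> rank X1 \<le> k \<longrightarrow>
         (\<exists>H1 H2. X = H1 + H2 \<and> rank H1 \<le> 2 * k \<and> frob_inner H1 H2 = 0 \<and>
            X1 ** cadj H2 = 0 \<and> cadj X1 ** H2 = 0 \<and>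
            nuclear_norm H1 \<le> \<eta> * nuclear_norm H2)))"

definition j_eps :: "real \<Rightarrow> real \<Rightarrow> real" where
  "j_eps e u = (if \<bar>u\<bar> \<ge> e then \<bar>u\<bar> else (u\<^sup>2 + e\<^sup>2) / (2 * e))"

definition J_eps :: "real \<Rightarrow> complex^'p^'n \<Rightarrow> real" where
  "J_eps e X = (\<Sum>i=1..CARD('n). j_eps e (sing_val X i))"

text \<open>
  A fixed numbering of the index type, needed to write \<open>diag(\<sigma>\<^sub>1, \<dots>, \<sigma>\<^sub>n)\<close> as a matrix indexed
  by \<open>'n\<close>. The choice is immaterial: another numbering only permutes the columns of \<open>U\<close> in
  the definition of \<open>irls_weight\<close>.
\<close>

definition index_no :: "'n::finite \<Rightarrow> nat" where
  "index_no = (SOME f. bij_betw f UNIV {1..CARD('n)})"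

text \<open>
  The weight matrix for \<open>e > 0\<close>. It does not depend on which unitary diagonalization
  of \<open>X X\<^sup>*\<close> is used, which is why a definite description is appropriate.
\<close>

definition irls_weight :: "complex^'p^'n \<Rightarrow> real \<Rightarrow> complex^'n^'n" where
  "irls_weight X e = (THE W. \<exists>U. unitary_mat U \<and>
      X ** cadj X = U ** diag_mat (\<lambda>j. (sing_val X (index_no j))\<^sup>2) ** cadj U \<and>
      W = U ** diag_mat (\<lambda>j. inverse (max (sing_val X (index_no j)) e)) ** cadj U)"

text \<open>
  The state after step \<open>l\<close> is the triple of \<open>X\<^sup>l\<close>, \<open>\<epsilon>\<^sub>l\<close> and \<open>W\<^sup>l\<close>. There is no \<open>X\<^sup>0\<close> in
  the algorithm; the initial \<open>0\<close> is a placeholder that is never read. Likewise the weight is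
  never read once \<open>\<epsilon>\<^sub>l = 0\<close>.
\<close>

primrec irls_state ::
  "(complex^'p^'n \<Rightarrow> complex^'m) \<Rightarrow> complex^'m \<Rightarrow> nat \<Rightarrow> real \<Rightarrow> nat \<Rightarrow>
     (complex^'p^'n) \<times> real \<times> (complex^'n^'n)" where
  "irls_state S M K \<gamma> 0 = (0, 1, mat 1)"
| "irls_state S M K \<gamma> (Suc l) =
     (case irls_state S M K \<gamma> l of (X, e, W) \<Rightarrow>
        if e = 0 then (X, e, W)
        else let X' = arg_min (\<lambda>Y. (norm (psd_sqrt W ** Y))\<^sup>2) (\<lambda>Y. S Y = M);
                 e' = min e (\<gamma> * sing_val X' (K + 1))
             in (X', e', irls_weight X' e'))"

definition irls_X ::
  "(complex^'p^'n \<Rightarrow> complex^'m) \<Rightarrow> complex^'m \<Rightarrow> nat \<Rightarrow> real \<Rightarrow> nat \<Rightarrow> complex^'p^'n" where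
  "irls_X S M K \<gamma> l = fst (irls_state S M K \<gamma> l)"

definition irls_eps ::
  "(complex^'p^'n \<Rightarrow> complex^'m) \<Rightarrow> complex^'m \<Rightarrow> nat \<Rightarrow> real \<Rightarrow> nat \<Rightarrow> real" where
  "irls_eps S M K \<gamma> l = fst (snd (irls_state S M K \<gamma> l))"

definition accumulation_point :: "(nat \<Rightarrow> 'a::topological_space) \<Rightarrow> 'a \<Rightarrow> bool" where
  "accumulation_point X x \<longleftrightarrow> (\<exists>r. strict_mono r \<and> (X \<circ> r) \<longlonglongrightarrow> x)"

end

theory Submission
  imports Defs "HOL-Combinatorics.Permutations"
begin

text \<open>
  On \<open>t \<ge> 0\<close> the function \<open>j_eps e\<close> is the maximum of \<open>t * q - e / 2 * (q\<^sup>2 - 1)\<close> over \<open>0 \<le> q \<le> 1\<close>.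
  Hence \<open>J_eps e Y\<close> is the maximum of \<open>Re \<langle>Y, V\<rangle> - e / 2 * (\<parallel>V\<parallel>\<^sup>2 - n)\<close> over all contractions \<open>V\<close>, attained at
  \<open>V = W Y\<close> with the weight matrix \<open>W\<close> of the algorithm. For \<open>e = 0\<close> this is the duality of nuclear and
  operator norm. It yields the subgradient \<open>W X\<close> of \<open>J_eps e\<close> at \<open>X\<close>, the triangle inequality, and,
  through Young's inequality in an eigenbasis of \<open>W\<close>, the quadratic majorant
  \<open>J_eps e X + (\<langle>W Y, Y\<rangle> - \<langle>W X, X\<rangle>) / 2\<close> of \<open>J_eps e Y\<close>. Each iteration minimizes this majorant, so
  \<open>J_eps\<close> decreases along the iterates and consecutive iterates approach each other.

  In the null space property, \<open>X\<^sub>1\<close> may be any matrix of rank at most \<open>k\<close>, in particular an approximation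
  of a competitor \<open>X\<close>. This gives
  \<open>\<parallel>Y - X\<parallel> \<le> (1 + \<eta>) / (1 - \<eta>) * (\<parallel>Y\<parallel> - \<parallel>X\<parallel> + 2 * \<rho>\<^sub>k(X))\<close> for the nuclear norm. If \<open>\<epsilon>\<^sub>l\<close> tends to 0, the limit of a
  subsequence along which \<open>\<epsilon>\<^sub>l\<close> is attained by the singular value has rank at most \<open>K\<close>, so it is the unique
  minimizer, and the values \<open>\<parallel>X\<^sup>l\<parallel>\<close> converge. If \<open>\<epsilon>\<^sub>l\<close> tends to \<open>\<epsilon> > 0\<close>, the error bound follows from
  \<open>(K + 1 - k) * n * \<epsilon> \<le> (K + 1 - k) * \<sigma>\<^bsub>K+1\<^esub> \<le> \<rho>\<^sub>k\<close>.
\<close>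

section \<open>Hermitian matrices\<close>

text \<open>Linear in the first argument. Complex orthogonality needs this value; the real inner
  product of the library is its real part. Vectors are treated as rows, on which matrices act by
  \<open>v*\<close>.\<close>

definition hinner :: "complex^'n \<Rightarrow> complex^'n \<Rightarrow> complex" where
  "hinner x y = (\<Sum>i\<in>UNIV. x $ i * cnj (y $ i))"

lemma Re_hinner: "Re (hinner x y) = x \<bullet> y"
  by (simp add: hinner_def inner_vec_def inner_complex_def)

lemma of_real_mult_inner: "(complex_of_real r * z) \<bullet> z = r * (norm z)\<^sup>2"
  by (simp add: inner_complex_def cmod_power2) (simp add: power2_eq_square algebra_simps)

lemma hinner_self: "hinner x x = complex_of_real ((norm x)\<^sup>2)"
  by (simp add: hinner_def complex_norm_square[symmetric] norm_vec_def L2_set_def sum_nonneg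
      flip: of_real_sum of_real_power)

lemma hinner_commute: "hinner y x = cnj (hinner x y)"
  by (simp add: hinner_def mult.commute)

lemma hinner_add_left: "hinner (x + y) z = hinner x z + hinner y z"
  by (simp add: hinner_def sum.distrib algebra_simps)

lemma hinner_diff_left: "hinner (x - y) z = hinner x z - hinner y z"
  by (simp add: hinner_def sum_subtractf algebra_simps)

lemma hinner_scaleR_left: "hinner (r *\<^sub>R x) z = complex_of_real r * hinner x z"
  by (simp add: hinner_def sum_distrib_left scaleR_conv_of_real[where 'a=complex] mult.assoc)

lemma hinner_scaleR_right: "hinner x (r *\<^sub>R z) = complex_of_real r * hinner x z"
  by (simp add: hinner_def sum_distrib_left scaleR_conv_of_real[where 'a=complex] algebra_simps)

lemma hinner_adj: "hinner (x v* A) y = hinner x (y v* cadj A)"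
proof -
  have "hinner (x v* A) y = (\<Sum>j\<in>UNIV. \<Sum>i\<in>UNIV. x $ i * A $ i $ j * cnj (y $ j))"
    by (simp add: hinner_def vector_matrix_mult_def sum_distrib_right)
  also have "\<dots> = (\<Sum>i\<in>UNIV. \<Sum>j\<in>UNIV. x $ i * A $ i $ j * cnj (y $ j))"
    by (rule sum.swap)
  also have "\<dots> = hinner x (y v* cadj A)"
    by (simp add: hinner_def vector_matrix_mult_def cadj_def sum_distrib_left algebra_simps)
  finally show ?thesis .
qed

lemma inner_vm_adj: "(x v* A) \<bullet> y = x \<bullet> (y v* cadj A)" for A :: "complex^'p^'n"
  by (metis Re_hinner hinner_adj)

lemma cadj_nth [simp]: "cadj X $ i $ j = cnj (X $ j $ i)"
  by (simp add: cadj_def)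

lemma cadj_cadj [simp]: "cadj (cadj X) = X"
  by (simp add: vec_eq_iff)

lemma cadj_mult: "cadj (A ** B) = cadj B ** cadj A"
  by (simp add: vec_eq_iff matrix_matrix_mult_def mult.commute)

lemma cadj_add: "cadj (A + B) = cadj A + cadj B"
  by (simp add: vec_eq_iff)

lemma cadj_zero [simp]: "cadj 0 = 0"
  by (simp add: vec_eq_iff)

lemma cadj_mat_one [simp]: "cadj (mat 1) = mat 1"
  by (simp add: vec_eq_iff mat_def)

lemma cadj_diag [simp]: "cadj (diag_mat d) = diag_mat d"
  by (simp add: vec_eq_iff diag_mat_def)

lemma matrix_diff_ldistrib: "A ** (B - C) = A ** B - A ** C" for A :: "'a::ring_1^'m^'n"
  by (simp add: vec_eq_iff matrix_matrix_mult_def sum_subtractf right_diff_distrib)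

lemma matrix_diff_rdistrib: "(A - B) ** C = A ** C - B ** C" for A :: "'a::ring_1^'m^'n"
  by (simp add: vec_eq_iff matrix_matrix_mult_def sum_subtractf left_diff_distrib)

lemma matrix_mult_add_rdistrib: "(A + B) ** C = A ** C + B ** C" for A :: "'a::ring_1^'m^'n"
  by (simp add: vec_eq_iff matrix_matrix_mult_def sum.distrib distrib_right)

lemma scaleR_vm: "(r *\<^sub>R x) v* A = r *\<^sub>R (x v* A)" for A :: "complex^'p^'n"
  by (simp add: vec_eq_iff vector_matrix_mult_def scaleR_sum_right)

lemma matrix_mult_row: "(A ** X) $ i = (A $ i) v* X" for A :: "complex^'m^'n"
  by (simp add: vec_eq_iff matrix_matrix_mult_def vector_matrix_mult_def mult.commute)

lemma matrix_inner_left: "(A ** X) \<bullet> Y = X \<bullet> (cadj A ** Y)" for A :: "complex^'m^'n" and X :: "complex^'p^'m"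
proof -
  have "(A ** X) \<bullet> Y = (\<Sum>i\<in>UNIV. \<Sum>j\<in>UNIV. \<Sum>k\<in>UNIV. Re (A $ i $ k * X $ k $ j * cnj (Y $ i $ j)))"
    by (simp add: inner_vec_def inner_complex_def matrix_matrix_mult_def sum_distrib_right
        flip: sum.distrib)
  also have "\<dots> = (\<Sum>i\<in>UNIV. \<Sum>k\<in>UNIV. \<Sum>j\<in>UNIV. Re (A $ i $ k * X $ k $ j * cnj (Y $ i $ j)))"
    by (intro sum.cong refl sum.swap)
  also have "\<dots> = (\<Sum>k\<in>UNIV. \<Sum>i\<in>UNIV. \<Sum>j\<in>UNIV. Re (A $ i $ k * X $ k $ j * cnj (Y $ i $ j)))"
    by (rule sum.swap)
  also have "\<dots> = (\<Sum>k\<in>UNIV. \<Sum>j\<in>UNIV. \<Sum>i\<in>UNIV. Re (A $ i $ k * X $ k $ j * cnj (Y $ i $ j)))"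
    by (intro sum.cong refl sum.swap)
  also have "\<dots> = X \<bullet> (cadj A ** Y)"
    by (simp add: inner_vec_def inner_complex_def matrix_matrix_mult_def sum_distrib_left
        algebra_simps sum.distrib sum_subtractf)
  finally show ?thesis .
qed

lemma mult_cadj_nth: "(X ** cadj Y) $ i $ j = hinner (X $ i) (Y $ j)"
  by (simp add: hinner_def matrix_matrix_mult_def)

lemma diag_mat_mult_row [simp]: "(diag_mat d ** X) $ i = d i *\<^sub>R X $ i"
  by (simp add: vec_eq_iff matrix_matrix_mult_def diag_mat_def if_distrib if_distribR
      scaleR_conv_of_real[where 'a=complex] cong: if_cong)

lemma mult_diag_nth: "(X ** diag_mat d) $ i $ j = complex_of_real (d j) * X $ i $ j"
  by (simp add: matrix_matrix_mult_def diag_mat_def if_distrib if_distribR cong: if_cong)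

lemma diag_mat_mult: "diag_mat d ** diag_mat e = diag_mat (\<lambda>i. d i * e i)"
  by (simp add: vec_eq_iff mult_diag_nth) (simp add: diag_mat_def scaleR_conv_of_real[where 'a=complex])

lemma diag_mat_one: "diag_mat (\<lambda>i. 1) = mat 1"
  by (simp add: vec_eq_iff diag_mat_def mat_def)

lemma unitary_cadj: "unitary_mat U \<Longrightarrow> unitary_mat (cadj U)"
  by (simp add: unitary_mat_def)

lemma unitary_cadj_mult: "unitary_mat U \<Longrightarrow> cadj U ** U = mat 1" "unitary_mat U \<Longrightarrow> U ** cadj U = mat 1"
  by (auto simp: unitary_mat_def)

lemma unitary_cancel [simp]:
  assumes "unitary_mat U"
  shows "cadj U ** (U ** X) = X" "U ** (cadj U ** X) = X"
  using assms by (auto simp: unitary_mat_def matrix_mul_assoc)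

lemma unitary_cancel_right [simp]:
  assumes "unitary_mat U"
  shows "X ** cadj U ** U = X" "X ** U ** cadj U = X"
  using assms by (auto simp: unitary_mat_def simp flip: matrix_mul_assoc)

lemma unitary_norm_vm:
  assumes "unitary_mat U" shows "norm (c v* U) = norm c"
proof -
  have "(c v* U) \<bullet> (c v* U) = c \<bullet> c"
    using assms by (simp add: inner_vm_adj vector_matrix_mul_assoc unitary_mat_def)
  then show ?thesis by (simp add: norm_eq_sqrt_inner)
qed

lemma unitary_inner:
  assumes "unitary_mat U" shows "(U ** X) \<bullet> (U ** Y) = X \<bullet> (Y :: complex^'p^'n)"
  using assms by (simp add: matrix_inner_left)

lemma unitary_row_norm:
  assumes "unitary_mat U" shows "norm (U $ i) = 1"
proof -
  have "hinner (U $ i) (U $ i) = 1"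
    using assms by (simp add: mult_cadj_nth[symmetric] unitary_mat_def mat_def)
  then show ?thesis
    by (simp add: hinner_self abs_square_eq_1 flip: of_real_power)
qed

section \<open>Spectral theorem for Hermitian matrices by maximizing the Rayleigh quotient\<close>

lemma vec_dim_insert_0: "vec.dim (insert 0 B) = vec.dim B"
  by (metis vec.dim_span vec.span_insert_0)

text \<open>Padded with zero rows, the vectors of \<open>B\<close> form a square matrix whose row
  rank is too small for invertibility, so it has a nonzero kernel vector. The pairing is bilinear,
  without conjugation.\<close>

lemma finite_nonzero_annihilator:
  fixes B :: "(complex^'n) set"
  assumes "finite B" "card B < CARD('n)"
  shows "\<exists>c. c \<noteq> 0 \<and> (\<forall>b\<in>B. (\<Sum>i\<in>UNIV. c $ i * b $ i) = 0)"
proof -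
  obtain g :: "complex^'n \<Rightarrow> 'n" where g: "inj_on g B"
    using assms by (meson card_le_inj finite less_imp_le_nat finite_code)
  define N :: "complex^'n^'n" where "N = (\<chi> i. if i \<in> g ` B then the_inv_into B g i else 0)"
  have gN: "N $ g b = b" if "b \<in> B" for b
    using that g by (simp add: N_def the_inv_into_f_f)
  have rows: "rows N \<subseteq> insert 0 B"
    using g by (auto simp: rows_def row_def N_def the_inv_into_f_f)
  have "vec.dim (rows N) \<le> vec.dim (insert 0 B)"
    using rows by (metis vec_dim_insert_0 vec.dim_subset)
  also have "\<dots> \<le> card B"
    using assms by (metis vec_dim_insert_0 vec.dim_le_card')
  finally have "vec.dim (rows N) < CARD('n)" using assms by simp
  then have "vec.span (rows N) \<noteq> UNIV"
    by (metis less_irrefl vec.dim_span vec_dim_card)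
  then have "\<not> (\<exists>B. B ** N = mat 1)"
    by (simp add: matrix_left_invertible_span_rows_gen)
  then obtain c where "c \<noteq> 0" "N *v c = 0"
    by (meson matrix_left_invertible_ker)
  moreover have "(\<Sum>i\<in>UNIV. c $ i * b $ i) = 0" if "b \<in> B" for b
  proof -
    have "(N *v c) $ g b = 0" using \<open>N *v c = 0\<close> by simp
    then show ?thesis using gN[OF that] by (simp add: matrix_vector_mult_def mult.commute)
  qed
  ultimately show ?thesis by blast
qed

lemma linear_coeff_zero:
  fixes a b :: real
  assumes "\<And>t. a * t + b * t\<^sup>2 \<le> 0"
  shows "a = 0"
proof (rule ccontr)
  assume "a \<noteq> 0"
  \<comment> \<open>With this \<open>t\<close> the linear term \<open>a * t\<close> equals
    \<open>2 * (\<bar>b\<bar> + 1) * t\<^sup>2\<close> and outweighs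
    \<open>\<bar>b\<bar> * t\<^sup>2\<close>.\<close>
  define t where "t = a / (\<bar>b\<bar> + 1) / 2"
  have "a * t + b * t\<^sup>2 \<ge> a * t - \<bar>b\<bar> * t\<^sup>2"
    by (smt (verit) mult_right_mono zero_le_power2 abs_ge_minus_self mult_minus_left)
  also have "a * t - \<bar>b\<bar> * t\<^sup>2 = t\<^sup>2 * (2 * (\<bar>b\<bar> + 1) - \<bar>b\<bar>)"
  proof -
    have "\<bar>b\<bar> + 1 \<noteq> 0" by linarith
    then have "a = t * (2 * (\<bar>b\<bar> + 1))" by (simp add: t_def mult.commute del: distrib_left_numeral)
    then have "a * t = t * (2 * (\<bar>b\<bar> + 1)) * t" by (rule arg_cong)
    also have "\<dots> = t\<^sup>2 * (2 * (\<bar>b\<bar> + 1))" by (simp add: power2_eq_square)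
    finally show ?thesis by (simp only: right_diff_distrib mult.commute[of "t\<^sup>2"])
  qed
  moreover have "t\<^sup>2 * (2 * (\<bar>b\<bar> + 1) - \<bar>b\<bar>) > 0"
    using \<open>a \<noteq> 0\<close> by (intro mult_pos_pos) (auto simp: t_def add_nonneg_eq_0_iff)
  ultimately show False using assms[of t] by linarith
qed

text \<open>The orthogonal complement \<open>V\<close> of the eigenvectors found so far is invariant
  under \<open>A\<close>. A maximizer of the quadratic form on the unit sphere of \<open>V\<close>
  is an eigenvector, with the maximum as its eigenvalue.\<close>

lemma hermitian_eigenvector_step:
  fixes A :: "complex^'n^'n"
  assumes A: "cadj A = A" and E: "finite E" "card E < CARD('n)"
    and eig: "\<And>e. e \<in> E \<Longrightarrow> e v* A = l e *\<^sub>R e"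
  shows "\<exists>x m. norm x = 1 \<and> x v* A = (m::real) *\<^sub>R x \<and> (\<forall>e\<in>E. hinner x e = 0)"
proof -
  define V where "V = {x. \<forall>e\<in>E. hinner x e = 0}"
  define f where "f x = (x v* A) \<bullet> x" for x
  have V_add: "x + t *\<^sub>R y \<in> V" if "x \<in> V" "y \<in> V" for x y t
    using that by (simp add: V_def hinner_add_left hinner_scaleR_left)
  \<comment> \<open>Conjugation turns the bilinear conditions of
    \<open>finite_nonzero_annihilator\<close> into orthogonality for \<open>hinner\<close>; thus
    \<open>V\<close> is nonzero.\<close>
  have "card ((\<lambda>e. \<chi> i. cnj (e $ i)) ` E :: (complex^'n) set) < CARD('n)"
    using card_image_le[OF E(1)] E(2) by (rule order_le_less_trans)
  then obtain c where c: "c \<noteq> 0"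
    "\<forall>b\<in>(\<lambda>e. \<chi> i. cnj (e $ i)) ` E. (\<Sum>i\<in>UNIV. c $ i * b $ i) = 0"
    using finite_nonzero_annihilator[OF finite_imageI[OF E(1)]] by blast
  have "c \<in> V"
  proof -
    have "hinner c e = 0" if "e \<in> E" for e
      using c(2) that by (auto simp: hinner_def)
    then show ?thesis by (simp add: V_def)
  qed
  have clV: "closed V"
  proof -
    have "V = (\<Inter>e\<in>E. {x. hinner x e = 0})" by (auto simp: V_def)
    moreover have "closed {x. hinner x e = 0}" for e :: "complex^'n"
      unfolding hinner_def by (intro closed_Collect_eq continuous_intros)
    ultimately show ?thesis by auto
  qed
  have cont: "continuous_on S f" for S
    unfolding f_def vector_matrix_mult_def by (intro continuous_intros)
  have "compact (sphere 0 1 \<inter> V)" using clV by (intro compact_Int_closed) auto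
  moreover have "(1 / norm c) *\<^sub>R c \<in> sphere 0 1 \<inter> V"
    using \<open>c \<in> V\<close> \<open>c \<noteq> 0\<close> by (auto simp: V_def hinner_scaleR_left)
  ultimately obtain x where x: "x \<in> sphere 0 1 \<inter> V" and
    max: "\<And>y. y \<in> sphere 0 1 \<inter> V \<Longrightarrow> f y \<le> f x"
    using continuous_attains_sup[OF _ _ cont] by (metis empty_iff)
  have nx: "norm x = 1" "x \<in> V" using x by auto
  define m where "m = f x"
  have f_scale: "f (r *\<^sub>R y) = r\<^sup>2 * f y" for r y
    by (simp add: f_def power2_eq_square scaleR_vm)
  have bound: "f y \<le> m * (norm y)\<^sup>2" if "y \<in> V" for y
  proof (cases "y = 0")
    case True then show ?thesis by (simp add: f_def)
  next
    case False
    have "f ((1 / norm y) *\<^sub>R y) \<le> m"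
      unfolding m_def using that False by (intro max) (auto simp: V_def hinner_scaleR_left)
    then show ?thesis using False by (simp add: f_scale field_simps)
  qed
  \<comment> \<open>The residual of the eigenvalue equation lies in \<open>V\<close> again, so it is
    an admissible variation of \<open>x\<close>; the first-order condition in this direction forces
    \<open>y \<bullet> y = 0\<close>.\<close>
  define y where "y = x v* A - m *\<^sub>R x"
  have "y \<in> V"
    using \<open>x \<in> V\<close> A eig by (auto simp: V_def y_def hinner_diff_left hinner_scaleR_left hinner_adj hinner_scaleR_right)
  have sym: "(y v* A) \<bullet> x = (x v* A) \<bullet> y"
    by (subst inner_vm_adj) (simp add: A inner_commute)
  have "2 * ((x v* A) \<bullet> y - m * (x \<bullet> y)) = 0"
  proof (rule linear_coeff_zero)
    fix t
    have "f (x + t *\<^sub>R y) \<le> m * (norm (x + t *\<^sub>R y))\<^sup>2"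
      by (intro bound V_add \<open>x \<in> V\<close> \<open>y \<in> V\<close>)
    also have "f (x + t *\<^sub>R y) = m + 2 * t * ((x v* A) \<bullet> y) + t\<^sup>2 * f y"
      using sym by (simp add: m_def f_def vector_matrix_left_distrib inner_add_left inner_add_right
          power2_eq_square scaleR_vm algebra_simps)
    also have "(norm (x + t *\<^sub>R y))\<^sup>2 = 1 + 2 * t * (x \<bullet> y) + t\<^sup>2 * (y \<bullet> y)"
      using nx unfolding power2_norm_eq_inner norm_eq_1
      by (simp add: inner_add_left inner_add_right inner_commute power2_eq_square algebra_simps)
    finally show "2 * ((x v* A) \<bullet> y - m * (x \<bullet> y)) * t + (f y - m * (y \<bullet> y)) * t\<^sup>2 \<le> 0"
      by (simp add: algebra_simps)
  qed
  then have "y \<bullet> y = 0"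
    by (simp add: y_def[THEN arg_cong, of "\<lambda>z. z \<bullet> y"] inner_diff_left)
  then have "x v* A = m *\<^sub>R x" by (simp add: y_def)
  then show ?thesis using nx V_def by blast
qed

text \<open>Iterating the eigenvector step yields an orthonormal family of \<open>CARD('n)\<close>
  eigenvectors. They are the rows of \<open>Q\<close>, whose adjoint is the required
  \<open>U\<close>.\<close>

theorem hermitian_spectral:
  fixes A :: "complex^'n^'n"
  assumes A: "cadj A = A"
  shows "\<exists>U a. unitary_mat U \<and> A = U ** diag_mat a ** cadj U"
proof -
  have "\<exists>E l. finite E \<and> card E = k \<and> (\<forall>e\<in>E. e v* A = (l e::real) *\<^sub>R e \<and> norm e = 1) \<and>
      (\<forall>e\<in>E. \<forall>e'\<in>E. e \<noteq> e' \<longrightarrow> hinner e e' = 0)" if "k \<le> CARD('n)" for k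
    using that
  proof (induction k)
    case 0
    show ?case by (intro exI[of _ "{}"]) auto
  next
    case (Suc k)
    then have "k \<le> CARD('n)" by simp
    from Suc.IH[OF this] obtain E l where E: "finite E" "card E = k"
      "\<And>e. e \<in> E \<Longrightarrow> e v* A = (l e::real) *\<^sub>R e" "\<And>e. e \<in> E \<Longrightarrow> norm e = 1"
      "\<And>e e'. e \<in> E \<Longrightarrow> e' \<in> E \<Longrightarrow> e \<noteq> e' \<Longrightarrow> hinner e e' = 0"
      by blast
    obtain x m where x: "norm x = 1" "x v* A = (m::real) *\<^sub>R x" "\<And>e. e \<in> E \<Longrightarrow> hinner x e = 0"
      using hermitian_eigenvector_step[OF A E(1) _ E(3)] E(2) Suc.prems by auto
    have xE: "x \<notin> E" using x E by (force simp: hinner_self)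
    have x': "hinner e x = 0" if "e \<in> E" for e
      using x(3)[OF that] by (metis hinner_commute complex_cnj_zero)
    show ?case
      using E x xE x'
      by (intro exI[of _ "insert x E"] exI[of _ "l(x := m)"]) auto
  qed
  then obtain E l where E: "finite E" "card E = CARD('n)" "\<And>e. e \<in> E \<Longrightarrow> e v* A = (l e::real) *\<^sub>R e"
      "\<And>e. e \<in> E \<Longrightarrow> norm e = 1" "\<And>e e'. e \<in> E \<Longrightarrow> e' \<in> E \<Longrightarrow> e \<noteq> e' \<Longrightarrow> hinner e e' = 0"
    by (metis order_refl)
  obtain f :: "'n \<Rightarrow> complex^'n" where f: "bij_betw f UNIV E"
    using finite_same_card_bij[of "UNIV::'n set" E] E by auto
  have fE: "f i \<in> E" for i using f by (auto simp: bij_betw_def)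
  define Q :: "complex^'n^'n" where "Q = (\<chi> i. f i)"
  have "Q ** cadj Q = mat 1"
  proof -
    have "hinner (f i) (f j) = (if i = j then 1 else 0)" for i j
      using E(4)[OF fE[of i]] E(5)[OF fE[of i] fE[of j]] f
      by (auto simp: hinner_self bij_betw_def inj_on_def)
    then show ?thesis by (simp add: vec_eq_iff mult_cadj_nth mat_def Q_def)
  qed
  then have uQ: "unitary_mat Q" by (simp add: unitary_mat_def matrix_left_right_inverse)
  have "(Q ** A) $ i = (diag_mat (\<lambda>i. l (f i)) ** Q) $ i" for i
    using E(3)[OF fE] by (simp only: diag_mat_mult_row) (simp add: matrix_mult_row Q_def)
  then have "Q ** A = diag_mat (\<lambda>i. l (f i)) ** Q"
    by (subst vec_eq_iff) blast
  then have "A = cadj Q ** diag_mat (\<lambda>i. l (f i)) ** Q"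
    using uQ by (metis unitary_cancel(1) matrix_mul_assoc)
  then show ?thesis
    using uQ by (intro exI[of _ "cadj Q"] exI[of _ "\<lambda>i. l (f i)"]) (simp add: unitary_cadj)
qed

section \<open>Singular values and spectral functions\<close>

lemma sum_const_poly: "(\<Sum>i\<in>A. [:f i:]) = [:\<Sum>i\<in>A. f i:]"
  by (induction A rule: infinite_finite_induct) auto

text \<open>Constant polynomials embed matrices multiplicatively (\<open>C\<close>), and the scalar
  matrix \<open>T\<close> commutes with every matrix. So the similarity passes to
  \<open>T - C D\<close>, and the outer determinants cancel.\<close>

lemma charpoly_unitary:
  fixes D :: "complex^'n^'n"
  assumes "unitary_mat U"
  shows "charpoly (U ** D ** cadj U) = charpoly D"
proof -
  define C :: "complex^'n^'n \<Rightarrow> complex poly^'n^'n" where "C A = (\<chi> i j. [:A $ i $ j:])" for A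
  define T :: "complex poly^'n^'n" where "T = mat [:0, 1:]"
  have char: "charpoly A = det (T - C A)" for A
    unfolding charpoly_def by (rule arg_cong[of _ _ det]) (simp add: vec_eq_iff T_def C_def mat_def)
  have C_mult: "C (A ** B) = C A ** C B" for A B
    by (simp add: vec_eq_iff C_def matrix_matrix_mult_def mult.commute flip: sum_const_poly)
  have C_one: "C (mat 1) = mat 1"
    by (simp add: vec_eq_iff C_def mat_def one_pCons)
  have T_comm: "N ** T = T ** N" for N
    by (simp add: vec_eq_iff T_def matrix_matrix_mult_def mat_def if_distrib if_distribR mult.commute
        cong: if_cong)
  have U: "U ** cadj U = mat 1" using assms by (simp add: unitary_mat_def)
  have "C U ** (T - C D) ** C (cadj U) = T ** (C U ** C (cadj U)) - C U ** C D ** C (cadj U)"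
    by (simp add: matrix_diff_ldistrib matrix_diff_rdistrib T_comm matrix_mul_assoc)
  also have "\<dots> = T - C (U ** D ** cadj U)"
    using U by (simp add: C_one flip: C_mult)
  finally have "charpoly (U ** D ** cadj U) = det (C U ** (T - C D) ** C (cadj U))"
    by (simp add: char)
  also have "\<dots> = det (C U ** C (cadj U)) * det (T - C D)"
    by (simp add: det_mul)
  also have "\<dots> = charpoly D"
    using U by (simp add: C_one char flip: C_mult)
  finally show ?thesis .
qed

lemma charpoly_diag: "charpoly (diag_mat d) = (\<Prod>i\<in>UNIV. [:- complex_of_real (d i), 1:])"
  unfolding charpoly_def by (subst det_diagonal) (auto simp: diag_mat_def)

lemma proots_charpoly_diag:
  "proots (charpoly (diag_mat (d :: 'n::finite \<Rightarrow> real))) = image_mset (\<lambda>i. complex_of_real (d i)) (mset_set UNIV)"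
proof -
  have "(\<Sum>i\<in>A. {#complex_of_real (d i)#}) = image_mset (\<lambda>i. complex_of_real (d i)) (mset_set A)" for A :: "'n set"
    by (induction A rule: infinite_finite_induct) auto
  then show ?thesis by (simp add: charpoly_diag proots_prod)
qed

text \<open>Bridge from the characteristic polynomial to the spectral theorem: spectral sums may be
  computed in any unitary diagonalization, whatever the order of the eigenvalues.\<close>

lemma mset_sing_vals:
  fixes X :: "complex^'p^'n"
  assumes "unitary_mat U" "X ** cadj X = U ** diag_mat a ** cadj U"
  shows "mset (sing_vals X) = image_mset (\<lambda>i. sqrt (a i)) (mset_set UNIV)"
  using assms by (simp add: sing_vals_def charpoly_unitary proots_charpoly_diag multiset.map_comp o_def)

lemma gram_rows:
  assumes "unitary_mat U" "X ** cadj X = U ** diag_mat a ** cadj U"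
  shows "(cadj U ** X) ** cadj (cadj U ** X) = diag_mat a"
proof -
  have "(cadj U ** X) ** cadj (cadj U ** X) = cadj U ** (X ** cadj X) ** U"
    by (simp add: cadj_mult matrix_mul_assoc)
  also have "\<dots> = diag_mat a"
    using assms by (simp add: unitary_cadj_mult flip: matrix_mul_assoc)
  finally show ?thesis .
qed

text \<open>The rows of \<open>cadj U ** X\<close> are orthogonal, with Gram matrix
  \<open>diag_mat a\<close>. Thus \<open>sqrt (a i)\<close> is a row norm, and later estimates can
  be made row by row.\<close>

lemma gram_eigenvalue:
  fixes X :: "complex^'p^'n"
  assumes "unitary_mat U" "X ** cadj X = U ** diag_mat a ** cadj U"
  shows "a i = (norm ((cadj U ** X) $ i))\<^sup>2"
proof -
  have "hinner ((cadj U ** X) $ i) ((cadj U ** X) $ i) = complex_of_real (a i)"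
    unfolding mult_cadj_nth[symmetric] gram_rows[OF assms] by (simp add: diag_mat_def)
  then show ?thesis by (simp add: hinner_self flip: of_real_power)
qed

lemma gram_eigenvalue_nonneg:
  assumes "unitary_mat U" "X ** cadj X = U ** diag_mat a ** cadj U"
  shows "0 \<le> a i"
  by (simp add: gram_eigenvalue[OF assms])

lemma gram_spectral: "\<exists>U a. unitary_mat U \<and> X ** cadj X = U ** diag_mat a ** cadj U"
  by (rule hermitian_spectral) (simp add: cadj_mult)

lemma length_sing_vals: "length (sing_vals (X :: complex^'p^'n)) = CARD('n)"
proof -
  obtain U a where "unitary_mat U" "X ** cadj X = U ** diag_mat a ** cadj U"
    using gram_spectral by blast
  then show ?thesis by (metis mset_sing_vals size_image_mset size_mset size_mset_set)
qed

lemma sing_vals_nonneg: "s \<in> set (sing_vals X) \<Longrightarrow> 0 \<le> s"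
proof -
  assume s: "s \<in> set (sing_vals X)"
  obtain U a where U: "unitary_mat U" "X ** cadj X = U ** diag_mat a ** cadj U"
    using gram_spectral by blast
  have "s \<in># mset (sing_vals X)" using s by simp
  then show ?thesis using gram_eigenvalue_nonneg[OF U] unfolding mset_sing_vals[OF U] by auto
qed

lemma sing_val_nonneg: "0 \<le> sing_val X i"
  by (auto simp: sing_val_def length_sing_vals intro!: sing_vals_nonneg[of _ X])

lemma sing_val_antimono:
  assumes "1 \<le> i" "i \<le> j" shows "sing_val X j \<le> sing_val (X :: complex^'p^'n) i"
proof (cases "j \<le> CARD('n)")
  case True
  have "sorted (rev (sing_vals X))" by (simp add: sing_vals_def)
  then have "sing_vals X ! (j - 1) \<le> sing_vals X ! (i - 1)"
    using assms True by (intro sorted_rev_nth_mono) (auto simp: length_sing_vals)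
  then show ?thesis using assms True by (simp add: sing_val_def)
next
  case False
  then show ?thesis using sing_val_nonneg[of X i] by (simp add: sing_val_def)
qed

lemma image_mset_sing_val:
  "image_mset (sing_val X) (mset_set {1..CARD('n)}) = mset (sing_vals (X :: complex^'p^'n))"
proof -
  have "mset (sing_vals X) = image_mset (\<lambda>i. sing_vals X ! i) (mset_set {0..<CARD('n)})"
    by (metis length_sing_vals map_nth mset_map mset_upt)
  also have "\<dots> = image_mset (\<lambda>i. sing_val X (Suc i)) (mset_set {0..<CARD('n)})"
    by (intro image_mset_cong) (auto simp: sing_val_def)
  also have "\<dots> = image_mset (sing_val X) (image_mset Suc (mset_set {0..<CARD('n)}))"
    by (simp add: multiset.map_comp o_def)
  also have "image_mset Suc (mset_set {0..<CARD('n)}) = mset_set {1..CARD('n)}"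
    by (simp add: image_mset_mset_set image_Suc_atLeastLessThan atLeastLessThanSuc_atLeastAtMost)
  finally show ?thesis by simp
qed

lemma sum_sing_val:
  fixes X :: "complex^'p^'n" and f :: "real \<Rightarrow> real"
  assumes "unitary_mat U" "X ** cadj X = U ** diag_mat a ** cadj U"
  shows "(\<Sum>i=1..CARD('n). f (sing_val X i)) = (\<Sum>i\<in>UNIV. f (sqrt (a i)))"
proof -
  have "(\<Sum>i=1..CARD('n). f (sing_val X i)) = sum_mset (image_mset f (image_mset (sing_val X) (mset_set {1..CARD('n)})))"
    by (simp add: sum_unfold_sum_mset multiset.map_comp o_def)
  also have "\<dots> = sum_mset (image_mset f (image_mset (\<lambda>i. sqrt (a i)) (mset_set UNIV)))"
    by (simp only: image_mset_sing_val mset_sing_vals[OF assms])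
  also have "\<dots> = (\<Sum>i\<in>UNIV. f (sqrt (a i)))"
    by (simp add: sum_unfold_sum_mset multiset.map_comp o_def)
  finally show ?thesis .
qed

lemma J_eps_spectral:
  assumes "unitary_mat U" "X ** cadj X = U ** diag_mat a ** cadj U"
  shows "J_eps e X = (\<Sum>i\<in>UNIV. j_eps e (sqrt (a i)))"
  unfolding J_eps_def by (rule sum_sing_val[OF assms])

lemma nuclear_norm_eq_J: "nuclear_norm X = J_eps 0 X"
  by (simp add: nuclear_norm_def J_eps_def j_eps_def sing_val_nonneg)

lemma nuclear_norm_spectral:
  assumes "unitary_mat U" "X ** cadj X = U ** diag_mat a ** cadj U"
  shows "nuclear_norm X = (\<Sum>i\<in>UNIV. sqrt (a i))"
  unfolding nuclear_norm_def by (rule sum_sing_val[OF assms])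

section \<open>Ordered diagonalization, functional calculus and the weight matrix\<close>

lemma bij_index_no: "bij_betw (index_no :: 'n::finite \<Rightarrow> nat) UNIV {1..CARD('n)}"
proof -
  obtain h where "bij_betw h {1..CARD('n)} (UNIV :: 'n set)"
    using ex_bij_betw_nat_finite_1[of "UNIV :: 'n set"] by auto
  then have "\<exists>f. bij_betw f (UNIV :: 'n set) {1..CARD('n)}"
    by (blast intro: bij_betw_inv_into)
  then show ?thesis unfolding index_no_def by (rule someI_ex)
qed

lemma index_no_range: "1 \<le> index_no (j :: 'n::finite)" "index_no j \<le> CARD('n)"
  using bij_betwE[OF bij_index_no[where 'n='n]] by auto

lemma unitary_diag_nth:
  "(U ** diag_mat d ** cadj V) $ i $ k = (\<Sum>j\<in>UNIV. complex_of_real (d j) * (U $ i $ j * cnj (V $ k $ j)))"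
  by (simp add: mult_cadj_nth hinner_def mult_diag_nth mult.assoc)

text \<open>An arbitrary diagonalization has the same multiset of eigenvalues; permuting the columns
  of its unitary factor by \<open>p\<close> puts them in the order of
  \<open>index_no\<close>.\<close>

lemma svd_gram:
  fixes X :: "complex^'p^'n"
  shows "\<exists>U. unitary_mat U \<and> X ** cadj X = U ** diag_mat (\<lambda>j. (sing_val X (index_no j))\<^sup>2) ** cadj U"
proof -
  obtain U0 a where U0: "unitary_mat U0" "X ** cadj X = U0 ** diag_mat a ** cadj U0"
    using gram_spectral by blast
  let ?s = "\<lambda>j::'n. sing_val X (index_no j)"
  have "image_mset ?s (mset_set UNIV) = image_mset (sing_val X) (image_mset index_no (mset_set (UNIV :: 'n set)))"
    by (simp add: multiset.map_comp o_def)
  also have "\<dots> = image_mset (\<lambda>i. sqrt (a i)) (mset_set UNIV)"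
    using bij_index_no[where 'n='n]
    by (simp only: image_mset_mset_set bij_betw_def image_mset_sing_val mset_sing_vals[OF U0])
  finally have "image_mset ?s (mset_set UNIV) = image_mset (\<lambda>i. sqrt (a i)) (mset_set UNIV)" .
  from image_mset_eq_implies_permutes[OF _ this]
  obtain p where p: "p permutes (UNIV :: 'n set)" "\<And>j. ?s j = sqrt (a (p j))" by auto
  define U :: "complex^'n^'n" where "U = (\<chi> i j. U0 $ i $ p j)"
  have eq: "U ** diag_mat (\<lambda>j. d (p j)) ** cadj U = U0 ** diag_mat d ** cadj U0" for d
  proof -
    have "(\<Sum>j\<in>UNIV. g (p j)) = (\<Sum>j\<in>UNIV. g j)" for g :: "'n \<Rightarrow> complex"
      using sum.permute[OF p(1), of g] by (simp add: o_def)
    from this[of "\<lambda>j. complex_of_real (d j) * (U0 $ i $ j * cnj (U0 $ k $ j))" for i k]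
    show ?thesis by (simp add: vec_eq_iff unitary_diag_nth U_def)
  qed
  have "U ** cadj U = mat 1"
    using eq[of "\<lambda>_. 1"] U0 by (simp add: diag_mat_one unitary_mat_def)
  then have "unitary_mat U" by (simp add: unitary_mat_def matrix_left_right_inverse)
  moreover have "(?s j)\<^sup>2 = a (p j)" for j
    using p(2) gram_eigenvalue_nonneg[OF U0] by simp
  ultimately show ?thesis using eq[of a] U0 by (intro exI[of _ U]) auto
qed

text \<open>Functional calculus is well defined: \<open>Q\<close> intertwines the two diagonal
  matrices, so its entry at \<open>i\<close>, \<open>j\<close> vanishes unless
  \<open>a i = b j\<close>, and then the values of \<open>f\<close> agree too.\<close>

lemma spectral_intertwine:
  fixes U V :: "complex^'n^'n"
  assumes U: "unitary_mat U" and V: "unitary_mat V"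
    and eq: "U ** diag_mat a ** cadj U = V ** diag_mat b ** cadj V"
  shows "U ** diag_mat (\<lambda>i. f (a i)) ** cadj U = V ** diag_mat (\<lambda>i. f (b i)) ** cadj V"
proof -
  define Q where "Q = cadj U ** V"
  have "diag_mat a ** Q = cadj U ** (U ** diag_mat a ** cadj U) ** V"
    using U by (simp add: Q_def flip: matrix_mul_assoc)
  also have "\<dots> = Q ** diag_mat b"
    using V by (simp add: eq Q_def matrix_mul_assoc)
  finally have "(diag_mat a ** Q) $ i $ j = (Q ** diag_mat b) $ i $ j" for i j by simp
  then have ab: "complex_of_real (a i) * Q $ i $ j = complex_of_real (b j) * Q $ i $ j" for i j
    by (simp add: mult_diag_nth scaleR_conv_of_real[where 'a=complex])
  have "diag_mat (\<lambda>i. f (a i)) ** Q = Q ** diag_mat (\<lambda>i. f (b i))"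
  proof -
    have "complex_of_real (f (a i)) * Q $ i $ j = complex_of_real (f (b j)) * Q $ i $ j" for i j
      using ab[of i j] by (cases "Q $ i $ j = 0") auto
    then show ?thesis by (simp add: vec_eq_iff mult_diag_nth scaleR_conv_of_real[where 'a=complex])
  qed
  then have "U ** (diag_mat (\<lambda>i. f (a i)) ** Q) ** cadj V = U ** (Q ** diag_mat (\<lambda>i. f (b i))) ** cadj V"
    by simp
  then show ?thesis using U V unfolding Q_def
    by (simp add: matrix_mul_assoc unitary_cadj_mult)
qed

text \<open>The weight is the function \<open>inverse (max (sqrt t) e)\<close> of
  \<open>X ** cadj X\<close>. Hence exactly one matrix meets the definite description, and any
  diagonalization may replace the ordered one.\<close>

lemma irls_weight_spectral:
  fixes X :: "complex^'p^'n"
  assumes U: "unitary_mat U" "X ** cadj X = U ** diag_mat a ** cadj U"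
  shows "irls_weight X e = U ** diag_mat (\<lambda>j. inverse (max (sqrt (a j)) e)) ** cadj U"
proof -
  have uniq: "V ** diag_mat (\<lambda>j. inverse (max (sing_val X (index_no j)) e)) ** cadj V =
      U ** diag_mat (\<lambda>j. inverse (max (sqrt (a j)) e)) ** cadj U"
    if V: "unitary_mat V" "X ** cadj X = V ** diag_mat (\<lambda>j. (sing_val X (index_no j))\<^sup>2) ** cadj V" for V
    using spectral_intertwine[OF V(1) U(1), of "\<lambda>j. (sing_val X (index_no j))\<^sup>2" a "\<lambda>t. inverse (max (sqrt t) e)"]
      U(2) V(2) by (simp add: sing_val_nonneg)
  obtain V where V: "unitary_mat V"
    "X ** cadj X = V ** diag_mat (\<lambda>j. (sing_val X (index_no j))\<^sup>2) ** cadj V"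
    using svd_gram by blast
  show ?thesis
    unfolding irls_weight_def
  proof (rule the_equality)
    show "\<exists>V. unitary_mat V \<and> X ** cadj X = V ** diag_mat (\<lambda>j. (sing_val X (index_no j))\<^sup>2) ** cadj V \<and>
        U ** diag_mat (\<lambda>j. inverse (max (sqrt (a j)) e)) ** cadj U =
        V ** diag_mat (\<lambda>j. inverse (max (sing_val X (index_no j)) e)) ** cadj V"
      using V uniq[OF V] by metis
  qed (use uniq in blast)
qed

lemma quadform_eq_inner: "Re (\<Sum>i\<in>UNIV. cnj (x $ i) * (A *v x) $ i) = (A *v x) \<bullet> x"
  by (simp add: inner_vec_def inner_complex_def mult.commute)

lemma matrix_vector_inner_left: "(A *v x) \<bullet> y = x \<bullet> (cadj A *v y)" for A :: "complex^'m^'n"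
proof -
  have "(A *v x) \<bullet> y = (\<Sum>i\<in>UNIV. \<Sum>k\<in>UNIV. Re (A $ i $ k * x $ k * cnj (y $ i)))"
    by (simp add: inner_vec_def inner_complex_def matrix_vector_mult_def sum_distrib_right
        flip: sum.distrib)
  also have "\<dots> = (\<Sum>k\<in>UNIV. \<Sum>i\<in>UNIV. Re (A $ i $ k * x $ k * cnj (y $ i)))"
    by (rule sum.swap)
  also have "\<dots> = x \<bullet> (cadj A *v y)"
    by (simp add: inner_vec_def inner_complex_def matrix_vector_mult_def sum_distrib_left
        algebra_simps sum.distrib sum_subtractf)
  finally show ?thesis .
qed

lemma psd_unitary_diag:
  assumes "unitary_mat U"
  shows "psd_mat (U ** diag_mat a ** cadj U) \<longleftrightarrow> (\<forall>i. 0 \<le> a i)"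
proof -
  have herm: "cadj (U ** diag_mat a ** cadj U) = U ** diag_mat a ** cadj U"
    by (simp add: cadj_mult matrix_mul_assoc)
  have dv: "(diag_mat a *v y) \<bullet> y = (\<Sum>i\<in>UNIV. a i * (norm (y $ i))\<^sup>2)" for y
    by (simp add: inner_vec_def matrix_vector_mult_def diag_mat_def if_distrib if_distribR cong: if_cong)
      (simp add: of_real_mult_inner)
  have q: "((U ** diag_mat a ** cadj U) *v x) \<bullet> x = (\<Sum>i\<in>UNIV. a i * (norm ((cadj U *v x) $ i))\<^sup>2)" for x
    unfolding dv[symmetric] by (simp add: matrix_vector_inner_left[of U] flip: matrix_vector_mul_assoc)
  show ?thesis
  proof
    assume psd: "psd_mat (U ** diag_mat a ** cadj U)"
    show "\<forall>i. 0 \<le> a i"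
    proof
      fix i
      have "cadj U *v (U *v axis i 1) = axis i 1"
        using assms by (simp add: matrix_vector_mul_assoc unitary_mat_def)
      then have "((U ** diag_mat a ** cadj U) *v (U *v axis i 1)) \<bullet> (U *v axis i 1) = a i"
        unfolding q by (simp add: axis_def if_distrib if_distribR cong: if_cong)
      then show "0 \<le> a i" using psd unfolding psd_mat_def quadform_eq_inner by metis
    qed
  next
    assume "\<forall>i. 0 \<le> a i"
    then show "psd_mat (U ** diag_mat a ** cadj U)"
      unfolding psd_mat_def quadform_eq_inner using herm by (auto simp: q intro!: sum_nonneg)
  qed
qed

text \<open>Uniqueness: a positive semidefinite root has its own diagonalization, whose squared
  eigenvalues diagonalize the same matrix; \<open>spectral_intertwine\<close> with
  \<open>sqrt\<close> identifies the two roots.\<close>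

lemma psd_sqrt_unitary_diag:
  fixes U :: "complex^'n^'n"
  assumes U: "unitary_mat U" and a: "\<And>i. 0 \<le> a i"
  shows "psd_sqrt (U ** diag_mat a ** cadj U) = U ** diag_mat (\<lambda>i. sqrt (a i)) ** cadj U"
  unfolding psd_sqrt_def
proof (rule the_equality)
  have sq: "(V ** diag_mat b ** cadj V) ** (V ** diag_mat b ** cadj V) = V ** diag_mat (\<lambda>i. (b i)\<^sup>2) ** cadj V"
    if "unitary_mat V" for V :: "complex^'n^'n" and b
  proof -
    have "(V ** diag_mat b ** cadj V) ** (V ** diag_mat b ** cadj V) = V ** (diag_mat b ** diag_mat b) ** cadj V"
      using that by (simp flip: matrix_mul_assoc)
    then show ?thesis by (simp add: diag_mat_mult power2_eq_square)
  qed
  show "psd_mat (U ** diag_mat (\<lambda>i. sqrt (a i)) ** cadj U) \<and>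
      (U ** diag_mat (\<lambda>i. sqrt (a i)) ** cadj U) ** (U ** diag_mat (\<lambda>i. sqrt (a i)) ** cadj U) =
      U ** diag_mat a ** cadj U"
    using U a by (simp add: psd_unitary_diag sq)
  fix B assume B: "psd_mat B \<and> B ** B = U ** diag_mat a ** cadj U"
  then obtain V b where V: "unitary_mat V" "B = V ** diag_mat b ** cadj V"
    using hermitian_spectral[of B] by (auto simp: psd_mat_def)
  have b: "0 \<le> b i" for i using B V psd_unitary_diag by blast
  have "V ** diag_mat (\<lambda>i. (b i)\<^sup>2) ** cadj V = U ** diag_mat a ** cadj U"
    using B V sq by metis
  from spectral_intertwine[OF V(1) U this, of sqrt]
  show "B = U ** diag_mat (\<lambda>i. sqrt (a i)) ** cadj U"
    using V(2) b by simp
qed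

section \<open>Duality for the smoothed nuclear norm\<close>

text \<open>The unit ball of the operator norm, which is dual to the nuclear norm.\<close>

definition contraction :: "complex^'p^'n \<Rightarrow> bool" where
  "contraction V \<longleftrightarrow> (\<forall>c. norm (c v* V) \<le> norm c)"

lemma inner_rows: "A \<bullet> B = (\<Sum>i\<in>UNIV. (A $ i) \<bullet> (B $ i))"
  by (rule inner_vec_def)

lemma inner_unitary_rows:
  assumes "unitary_mat U"
  shows "A \<bullet> B = (\<Sum>i\<in>UNIV. ((cadj U ** A) $ i) \<bullet> ((cadj U ** B) $ i))"
proof -
  have "A \<bullet> B = (cadj U ** A) \<bullet> (cadj U ** B)"
    by (rule unitary_inner[symmetric]) (rule unitary_cadj[OF assms])
  then show ?thesis by (simp add: inner_rows)
qed

lemma norm_sq_unitary_rows: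
  assumes "unitary_mat U"
  shows "(norm A)\<^sup>2 = (\<Sum>i\<in>UNIV. (norm ((cadj U ** A) $ i))\<^sup>2)"
  using inner_unitary_rows[OF assms, of A A] by (simp add: power2_norm_eq_inner)

lemma spectral_row:
  assumes "unitary_mat U"
  shows "(cadj U ** (U ** diag_mat w ** cadj U ** A)) $ i = w i *\<^sub>R (cadj U ** A) $ i"
proof -
  have "cadj U ** (U ** diag_mat w ** cadj U ** A) = diag_mat w ** (cadj U ** A)"
    using assms by (simp flip: matrix_mul_assoc)
  then show ?thesis by simp
qed

lemma quadform_spectral:
  assumes "unitary_mat U"
  shows "(U ** diag_mat w ** cadj U ** A) \<bullet> A = (\<Sum>i\<in>UNIV. w i * (norm ((cadj U ** A) $ i))\<^sup>2)"
  unfolding inner_unitary_rows[OF assms] spectral_row[OF assms]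
  by (simp add: power2_norm_eq_inner)

lemma norm_vm_gram:
  assumes "X ** cadj X = U ** diag_mat a ** cadj U"
  shows "(norm (c v* X))\<^sup>2 = (\<Sum>i\<in>UNIV. a i * (norm ((c v* U) $ i))\<^sup>2)"
proof -
  have dv: "(b v* diag_mat a) \<bullet> b = (\<Sum>i\<in>UNIV. a i * (norm (b $ i))\<^sup>2)" for b
    by (simp add: inner_vec_def vector_matrix_mult_def diag_mat_def if_distrib if_distribR cong: if_cong)
      (simp add: of_real_mult_inner mult.commute[of "_ $ _"])
  have "(norm (c v* X))\<^sup>2 = (c v* (X ** cadj X)) \<bullet> c"
    unfolding power2_norm_eq_inner using inner_vm_adj[of "c v* X" "cadj X" c]
    by (simp add: vector_matrix_mul_assoc)
  also have "\<dots> = ((c v* U) v* diag_mat a) \<bullet> (c v* U)"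
    unfolding assms by (simp add: inner_vm_adj[of _ "cadj U"] flip: vector_matrix_mul_assoc)
  finally show ?thesis by (simp add: dv)
qed

lemma contraction_row:
  assumes "contraction V" "unitary_mat U"
  shows "norm ((cadj U ** V) $ i) \<le> 1"
  using assms unitary_row_norm[OF unitary_cadj[OF assms(2)], of i]
  unfolding contraction_def matrix_mult_row by metis

text \<open>\<open>V\<close> keeps the eigenbasis \<open>U\<close>, and its singular values are
  scaled by \<open>\<bar>w i\<bar>\<close>. The dual certificates and the residual of a truncation
  have this form.\<close>

lemma spectral_gram:
  assumes "unitary_mat U" "X ** cadj X = U ** diag_mat a ** cadj U"
    and "V = U ** diag_mat w ** cadj U ** X"
  shows "V ** cadj V = U ** diag_mat (\<lambda>i. (w i)\<^sup>2 * a i) ** cadj U"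
proof -
  have "V ** cadj V = U ** diag_mat w ** cadj U ** (X ** cadj X) ** U ** diag_mat w ** cadj U"
    unfolding assms(3) by (simp add: cadj_mult matrix_mul_assoc)
  also have "\<dots> = U ** (diag_mat w ** diag_mat a ** diag_mat w) ** cadj U"
    unfolding assms(2) using assms(1) by (simp flip: matrix_mul_assoc)
  finally show ?thesis by (simp add: diag_mat_mult power2_eq_square mult.assoc mult.commute mult.left_commute)
qed

lemma contraction_gram:
  assumes "unitary_mat U" "V ** cadj V = U ** diag_mat a ** cadj U" "\<And>i. a i \<le> 1"
  shows "contraction V"
  unfolding contraction_def
proof
  fix c
  have "(norm (c v* V))\<^sup>2 \<le> (\<Sum>i\<in>UNIV. (norm ((c v* U) $ i))\<^sup>2)"
    unfolding norm_vm_gram[OF assms(2)]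
    by (intro sum_mono mult_left_le_one_le) (use assms gram_eigenvalue_nonneg[OF assms(1,2)] in auto)
  also have "\<dots> = (norm (c v* U))\<^sup>2"
    by (simp add: norm_vec_def L2_set_def sum_nonneg)
  finally show "norm (c v* V) \<le> norm c"
    by (simp add: unitary_norm_vm[OF assms(1)] power2_le_iff_abs_le)
qed

section \<open>Scalar duality and Young inequalities for \<open>j_eps\<close>\<close>

lemma weight_mult_bounds:
  fixes t e :: real
  assumes "0 \<le> t" "0 \<le> e"
  shows "0 \<le> inverse (max t e) * t" "inverse (max t e) * t \<le> 1"
proof -
  have "inverse (max t e) * t \<le> inverse (max t e) * max t e"
    using assms by (intro mult_left_mono) auto
  also have "\<dots> \<le> 1" by (cases "max t e = 0") auto
  finally show "inverse (max t e) * t \<le> 1" .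
  show "0 \<le> inverse (max t e) * t" using assms by simp
qed

text \<open>For \<open>e \<le> t\<close> the gap is the product
  \<open>(1 - q) * (t - e / 2 * (1 + q))\<close> of nonnegative factors; otherwise it is the square
  \<open>(t - e * q)\<^sup>2 / (2 * e)\<close>.\<close>

lemma j_eps_dual_le:
  assumes "0 \<le> t" "0 \<le> q" "q \<le> 1" "0 \<le> e"
  shows "t * q - e / 2 * (q\<^sup>2 - 1) \<le> j_eps e t"
proof (cases "e \<le> t")
  case True
  have "e / 2 * (1 + q) \<le> t" using True assms mult_left_mono[of "1 + q" 2 "e / 2"] by simp
  then have "0 \<le> (1 - q) * (t - e / 2 * (1 + q))" using assms by (intro mult_nonneg_nonneg) auto
  also have "\<dots> = t - (t * q - e / 2 * (q\<^sup>2 - 1))" by (simp add: field_simps power2_eq_square)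
  finally show ?thesis using True assms by (simp add: j_eps_def)
next
  case False
  have "0 \<le> (t - e * q)\<^sup>2 / (2 * e)" using assms by simp
  also have "\<dots> = (t\<^sup>2 + e\<^sup>2) / (2 * e) - (t * q - e / 2 * (q\<^sup>2 - 1))"
    using False assms by (simp add: field_simps power2_eq_square)
  finally show ?thesis using False assms by (simp add: j_eps_def)
qed

text \<open>The maximizer is \<open>q = inverse (max t e) * t\<close>. At \<open>t = e = 0\<close>
  the convention \<open>inverse 0 = 0\<close> gives the right value.\<close>

lemma j_eps_dual_eq:
  assumes "0 \<le> t" "0 \<le> e"
  shows "inverse (max t e) * t\<^sup>2 - e / 2 * ((inverse (max t e))\<^sup>2 * t\<^sup>2 - 1) = j_eps e t"
proof (cases "e \<le> t")
  case True
  then show ?thesis using assms by (cases "t = 0") (auto simp: j_eps_def max_def power2_eq_square field_simps)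
next
  case False
  then show ?thesis using assms by (simp add: j_eps_def max_def field_simps power2_eq_square)
qed

text \<open>With the \<open>q\<close> that is optimal for \<open>e'\<close>, passing from
  \<open>e'\<close> to \<open>e\<close> lowers the dual expression by
  \<open>(e' - e) / 2 * (1 - q\<^sup>2)\<close>.\<close>

lemma j_eps_lipschitz:
  assumes "0 \<le> t" "0 \<le> e" "e \<le> e'"
  shows "j_eps e' t \<le> j_eps e t + (e' - e) / 2"
proof -
  define q where "q = inverse (max t e') * t"
  have q: "0 \<le> q" "q \<le> 1" using weight_mult_bounds[of t e] weight_mult_bounds[of t e'] assms by (auto simp: q_def)
  have "j_eps e' t = t * q - e' / 2 * (q\<^sup>2 - 1)"
    using j_eps_dual_eq[of t e'] assms by (simp add: q_def power2_eq_square algebra_simps)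
  also have "\<dots> = (t * q - e / 2 * (q\<^sup>2 - 1)) + (e' - e) / 2 - (e' - e) / 2 * q\<^sup>2"
    by (simp add: field_simps)
  also have "\<dots> \<le> j_eps e t + (e' - e) / 2"
    using j_eps_dual_le[OF assms(1) q assms(2)] assms(3)
    by (smt (verit) divide_nonneg_pos zero_le_mult_iff zero_le_power2)
  finally show ?thesis .
qed

lemma j_eps_mono:
  assumes "0 \<le> t" "0 \<le> e" "e \<le> e'"
  shows "j_eps e t \<le> j_eps e' t"
proof -
  define q where "q = inverse (max t e) * t"
  have q: "0 \<le> q" "q \<le> 1" using weight_mult_bounds[of t e] weight_mult_bounds[of t e'] assms by (auto simp: q_def)
  have "j_eps e t = t * q - e / 2 * (q\<^sup>2 - 1)"
    using j_eps_dual_eq[of t e] assms by (simp add: q_def power2_eq_square algebra_simps)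
  also have "\<dots> \<le> t * q - e' / 2 * (q\<^sup>2 - 1)"
    using assms q by (intro diff_left_mono mult_right_mono_neg) (auto simp: abs_square_le_1)
  also have "\<dots> \<le> j_eps e' t"
    using j_eps_dual_le[OF assms(1) q, of e'] assms by linarith
  finally show ?thesis .
qed

text \<open>Young's inequality
  \<open>2 * (t * q) \<le> w * t\<^sup>2 + q\<^sup>2 * inverse w\<close>, combined with
  \<open>e \<le> inverse w\<close> on the factor \<open>1 - q\<^sup>2\<close>. By
  \<open>j_eps_young_eq\<close>, the choice \<open>w = inverse (max t e)\<close> makes the right
  side \<open>j_eps e t\<close>.\<close>

lemma j_eps_young:
  fixes t q w e :: real
  assumes "0 \<le> q" "q \<le> 1" "0 < w" "w * e \<le> 1"
  shows "t * q - e / 2 * (q\<^sup>2 - 1) \<le> w * t\<^sup>2 / 2 + inverse w / 2"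
proof -
  have "0 \<le> w * (t - q * inverse w)\<^sup>2" using assms(3) by (intro mult_nonneg_nonneg) auto
  also have "\<dots> = w * t\<^sup>2 + q\<^sup>2 * inverse w - 2 * (t * q)"
    using assms by (simp add: power2_eq_square field_simps)
  finally have "2 * (t * q) \<le> w * t\<^sup>2 + q\<^sup>2 * inverse w" by simp
  moreover have "0 \<le> (1 - q\<^sup>2) * (inverse w - e)"
    using assms by (intro mult_nonneg_nonneg) (auto simp: abs_square_le_1 field_simps)
  ultimately show ?thesis by (simp add: field_simps)
qed

lemma j_eps_young_eq:
  assumes "0 \<le> t" "0 < e"
  shows "j_eps e t = inverse (max t e) * t\<^sup>2 / 2 + max t e / 2"
  using assms by (auto simp: j_eps_def max_def field_simps power2_eq_square)

text \<open>In an eigenbasis of \<open>Y ** cadj Y\<close> both sides split into rows. The rows of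
  \<open>V\<close> have norm at most 1 there, so Cauchy-Schwarz and \<open>j_eps_dual_le\<close>
  apply with that norm as \<open>q\<close>.\<close>

lemma J_eps_dual_le:
  fixes Y :: "complex^'p^'n"
  assumes V: "contraction V" and e: "0 \<le> e"
  shows "Y \<bullet> V - e / 2 * ((norm V)\<^sup>2 - real CARD('n)) \<le> J_eps e Y"
proof -
  obtain U a where U: "unitary_mat U" "Y ** cadj Y = U ** diag_mat a ** cadj U"
    using gram_spectral by blast
  define y v where "y i = (cadj U ** Y) $ i" and "v i = (cadj U ** V) $ i" for i
  have y: "sqrt (a i) = norm (y i)" for i by (simp add: y_def gram_eigenvalue[OF U])
  have "Y \<bullet> V - e / 2 * ((norm V)\<^sup>2 - real CARD('n)) =
      (\<Sum>i\<in>UNIV. y i \<bullet> v i - e / 2 * ((norm (v i))\<^sup>2 - 1))"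
    unfolding inner_unitary_rows[OF U(1)] norm_sq_unitary_rows[OF U(1)] y_def v_def
    by (simp add: sum_subtractf flip: sum_distrib_left sum_divide_distrib)
  also have "\<dots> \<le> (\<Sum>i\<in>UNIV. j_eps e (sqrt (a i)))"
  proof (rule sum_mono)
    fix i
    have "y i \<bullet> v i - e / 2 * ((norm (v i))\<^sup>2 - 1) \<le> norm (y i) * norm (v i) - e / 2 * ((norm (v i))\<^sup>2 - 1)"
      using norm_cauchy_schwarz[of "y i" "v i"] by simp
    also have "\<dots> \<le> j_eps e (norm (y i))"
      using contraction_row[OF V U(1), of i] e by (intro j_eps_dual_le) (auto simp: v_def)
    finally show "y i \<bullet> v i - e / 2 * ((norm (v i))\<^sup>2 - 1) \<le> j_eps e (sqrt (a i))" by (simp add: y)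
  qed
  also have "\<dots> = J_eps e Y" by (rule J_eps_spectral[OF U, symmetric])
  finally show ?thesis .
qed

lemma contraction_weight:
  assumes "0 \<le> e" shows "contraction (irls_weight X e ** X)"
proof -
  obtain U a where U: "unitary_mat U" "X ** cadj X = U ** diag_mat a ** cadj U"
    using gram_spectral by blast
  have "irls_weight X e ** X = U ** diag_mat (\<lambda>j. inverse (max (sqrt (a j)) e)) ** cadj U ** X"
    by (simp add: irls_weight_spectral[OF U])
  from spectral_gram[OF U this] show ?thesis
  proof (rule contraction_gram[OF U(1)])
    fix i
    have "0 \<le> inverse (max (sqrt (a i)) e) * sqrt (a i)" "inverse (max (sqrt (a i)) e) * sqrt (a i) \<le> 1"
      using assms gram_eigenvalue_nonneg[OF U, of i] by (auto intro!: weight_mult_bounds)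
    then have "(inverse (max (sqrt (a i)) e) * sqrt (a i))\<^sup>2 \<le> 1" by (simp add: abs_square_le_1)
    then show "(inverse (max (sqrt (a i)) e))\<^sup>2 * a i \<le> 1"
      using gram_eigenvalue_nonneg[OF U, of i] by (simp add: power_mult_distrib)
  qed
qed

text \<open>In the eigenbasis of \<open>X ** cadj X\<close> each row of \<open>V\<close> is a
  nonnegative multiple of the row of \<open>X\<close>, so Cauchy-Schwarz is an equality, and its
  norm is the optimal \<open>q\<close>.\<close>

lemma J_eps_dual_eq:
  fixes X :: "complex^'p^'n"
  assumes e: "0 \<le> e" and V: "V = irls_weight X e ** X"
  shows "X \<bullet> V - e / 2 * ((norm V)\<^sup>2 - real CARD('n)) = J_eps e X"
proof -
  obtain U a where U: "unitary_mat U" "X ** cadj X = U ** diag_mat a ** cadj U"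
    using gram_spectral by blast
  define w where "w = (\<lambda>j. inverse (max (sqrt (a j)) e))"
  have V': "V = U ** diag_mat w ** cadj U ** X"
    by (simp add: V irls_weight_spectral[OF U] w_def)
  have a: "(norm ((cadj U ** X) $ i))\<^sup>2 = a i" for i by (simp add: gram_eigenvalue[OF U])
  have "X \<bullet> V = (\<Sum>i\<in>UNIV. w i * a i)"
    by (simp add: inner_commute[of X] V' quadform_spectral[OF U(1)] a)
  moreover have "(norm V)\<^sup>2 = (\<Sum>i\<in>UNIV. (w i)\<^sup>2 * a i)"
    unfolding norm_sq_unitary_rows[OF U(1)] V' spectral_row[OF U(1)]
    by (simp add: power_mult_distrib a)
  ultimately have "X \<bullet> V - e / 2 * ((norm V)\<^sup>2 - real CARD('n)) =
      (\<Sum>i\<in>UNIV. w i * a i - e / 2 * ((w i)\<^sup>2 * a i - 1))"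
    by (simp add: sum_subtractf flip: sum_distrib_left sum_divide_distrib)
  also have "\<dots> = (\<Sum>i\<in>UNIV. j_eps e (sqrt (a i)))"
  proof (rule sum.cong)
    fix i
    show "w i * a i - e / 2 * ((w i)\<^sup>2 * a i - 1) = j_eps e (sqrt (a i))"
      using j_eps_dual_eq[of "sqrt (a i)" e] e gram_eigenvalue_nonneg[OF U, of i] by (simp add: w_def)
  qed simp
  also have "\<dots> = J_eps e X" by (rule J_eps_spectral[OF U, symmetric])
  finally show ?thesis .
qed

text \<open>The matrix \<open>irls_weight X e ** X\<close> is optimal in the dual formula at
  \<open>X\<close> and admissible at \<open>Y\<close>; in the difference, the terms involving it
  alone cancel.\<close>

lemma J_eps_subgradient:
  assumes "0 \<le> e"
  shows "J_eps e X + (irls_weight X e ** X) \<bullet> (Y - X) \<le> J_eps e Y"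
  using J_eps_dual_le[OF contraction_weight[OF assms] assms, of Y X] J_eps_dual_eq[OF assms refl, of X]
  unfolding inner_commute[of X] inner_commute[of Y] by (simp add: inner_diff_right)

text \<open>
  Because \<open>inverse 0 = 0\<close>, the weight with parameter 0 is a pseudoinverse, and
  \<open>irls_weight X 0 ** X\<close> is the partial isometry of the polar decomposition of \<open>X\<close>.
\<close>

lemma nuclear_norm_dual: "contraction V \<Longrightarrow> Y \<bullet> V \<le> nuclear_norm Y"
  using J_eps_dual_le[of V 0 Y] by (simp add: nuclear_norm_eq_J)

lemma nuclear_norm_dual_eq: "X \<bullet> (irls_weight X 0 ** X) = nuclear_norm X"
  using J_eps_dual_eq[of 0 _ X] by (simp add: nuclear_norm_eq_J)

lemma nuclear_norm_triangle: "nuclear_norm (X + Y) \<le> nuclear_norm X + nuclear_norm Y"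
proof -
  let ?V = "irls_weight (X + Y) 0 ** (X + Y)"
  have "nuclear_norm (X + Y) = X \<bullet> ?V + Y \<bullet> ?V"
    by (simp add: nuclear_norm_dual_eq[symmetric] inner_add_left)
  then show ?thesis
    using nuclear_norm_dual[OF contraction_weight, of 0 X "X + Y"]
      nuclear_norm_dual[OF contraction_weight, of 0 Y "X + Y"] by simp
qed

lemma nuclear_norm_minus [simp]: "nuclear_norm (- X) = nuclear_norm X"
proof -
  have "(- X) ** cadj (- X) = X ** cadj X"
    by (simp add: vec_eq_iff matrix_matrix_mult_def)
  then show ?thesis by (simp add: nuclear_norm_def sing_val_def sing_vals_def)
qed

lemma nuclear_norm_minus_commute: "nuclear_norm (X - Y) = nuclear_norm (Y - X)"
  by (metis minus_diff_eq nuclear_norm_minus)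

lemma nuclear_norm_triangle_sub: "nuclear_norm X - nuclear_norm Y \<le> nuclear_norm (X - Y)"
  using nuclear_norm_triangle[of "X - Y" Y] by simp

lemma nuclear_norm_triangle_diff: "nuclear_norm (X - Z) \<le> nuclear_norm (X - Y) + nuclear_norm (Y - Z)"
  using nuclear_norm_triangle[of "X - Y" "Y - Z"] by simp

lemma nuclear_norm_nonneg: "0 \<le> nuclear_norm X"
  by (simp add: nuclear_norm_def sum_nonneg sing_val_nonneg)

lemma norm_le_nuclear_norm: "norm X \<le> nuclear_norm X"
proof -
  obtain U a where U: "unitary_mat U" "X ** cadj X = U ** diag_mat a ** cadj U"
    using gram_spectral by blast
  have nn: "nuclear_norm X = (\<Sum>i\<in>UNIV. norm ((cadj U ** X) $ i))"
    by (simp add: nuclear_norm_spectral[OF U] gram_eigenvalue[OF U])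
  have "(norm X)\<^sup>2 \<le> (nuclear_norm X)\<^sup>2"
    unfolding norm_sq_unitary_rows[OF U(1)] nn using L2_set_le_sum[of UNIV "\<lambda>i. norm ((cadj U ** X) $ i)"]
    by (simp add: L2_set_def real_sqrt_le_iff' sum_nonneg sqrt_le_D)
  then show ?thesis using nuclear_norm_nonneg power2_le_imp_le by blast
qed

lemma row_norm_le: "unitary_mat U \<Longrightarrow> norm ((cadj U ** X) $ i) \<le> norm X"
  by (metis Finite_Cartesian_Product.norm_nth_le norm_eq_sqrt_inner unitary_cadj unitary_inner)

lemma nuclear_norm_le_norm: "nuclear_norm X \<le> real CARD('n) * norm X" for X :: "complex^'p^'n"
proof -
  obtain U a where U: "unitary_mat U" "X ** cadj X = U ** diag_mat a ** cadj U"
    using gram_spectral by blast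
  have "nuclear_norm X = (\<Sum>i\<in>UNIV. norm ((cadj U ** X) $ i))"
    by (simp add: nuclear_norm_spectral[OF U] gram_eigenvalue[OF U])
  also have "\<dots> \<le> (\<Sum>i\<in>(UNIV::'n set). norm X)"
    by (intro sum_mono row_norm_le U)
  finally show ?thesis by simp
qed

lemma nuclear_norm_zero [simp]: "nuclear_norm (0 :: complex^'p^'n) = 0"
  using nuclear_norm_le_norm[of "0 :: complex^'p^'n"] nuclear_norm_nonneg[of "0 :: complex^'p^'n"] by simp

lemma nuclear_norm_eq_0: "nuclear_norm X \<le> 0 \<Longrightarrow> X = 0"
  using norm_le_nuclear_norm[of X] by (metis norm_le_zero_iff order_trans)

lemma J_eps_mono: "0 \<le> e \<Longrightarrow> e \<le> e' \<Longrightarrow> J_eps e X \<le> J_eps e' X"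
  unfolding J_eps_def by (intro sum_mono j_eps_mono sing_val_nonneg)

lemma J_eps_lipschitz:
  fixes X :: "complex^'p^'n"
  assumes "0 \<le> e" "e \<le> e'"
  shows "J_eps e' X \<le> J_eps e X + real CARD('n) * (e' - e) / 2"
proof -
  have "J_eps e' X \<le> (\<Sum>i=1..CARD('n). j_eps e (sing_val X i) + (e' - e) / 2)"
    unfolding J_eps_def by (intro sum_mono j_eps_lipschitz assms sing_val_nonneg)
  then show ?thesis by (simp add: J_eps_def sum.distrib)
qed

lemma nuclear_norm_le_J: "0 \<le> e \<Longrightarrow> nuclear_norm X \<le> J_eps e X"
  using J_eps_mono[of 0 e X] by (simp add: nuclear_norm_eq_J)

lemma J_le_nuclear_norm: "0 \<le> e \<Longrightarrow> J_eps e X \<le> nuclear_norm X + real CARD('n) * e / 2"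
  for X :: "complex^'p^'n"
  using J_eps_lipschitz[of 0 e X] by (simp add: nuclear_norm_eq_J)

text \<open>The rows are taken in the eigenbasis of the quadratic form, not of \<open>Y\<close>: the
  dual certificate \<open>V\<close> of \<open>Y\<close> has rows of norm at most 1 in every unitary
  basis, so \<open>j_eps_young\<close> applies to each row.\<close>

lemma J_eps_majorization:
  fixes Y :: "complex^'p^'n"
  assumes U: "unitary_mat U" and e: "0 \<le> e" and w: "\<And>i. 0 < w i" "\<And>i. w i * e \<le> 1"
  shows "J_eps e Y \<le> ((U ** diag_mat w ** cadj U ** Y) \<bullet> Y) / 2 + (\<Sum>i\<in>UNIV. inverse (w i)) / 2"
proof -
  define V where "V = irls_weight Y e ** Y"
  have V: "contraction V" unfolding V_def by (rule contraction_weight[OF e])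
  define y v where "y i = (cadj U ** Y) $ i" and "v i = (cadj U ** V) $ i" for i
  have "J_eps e Y = Y \<bullet> V - e / 2 * ((norm V)\<^sup>2 - real CARD('n))"
    using J_eps_dual_eq[OF e V_def] by simp
  also have "\<dots> = (\<Sum>i\<in>UNIV. y i \<bullet> v i - e / 2 * ((norm (v i))\<^sup>2 - 1))"
    unfolding inner_unitary_rows[OF U] norm_sq_unitary_rows[OF U] y_def v_def
    by (simp add: sum_subtractf flip: sum_distrib_left sum_divide_distrib)
  also have "\<dots> \<le> (\<Sum>i\<in>UNIV. w i * (norm (y i))\<^sup>2 / 2 + inverse (w i) / 2)"
  proof (rule sum_mono)
    fix i
    have "y i \<bullet> v i - e / 2 * ((norm (v i))\<^sup>2 - 1) \<le> norm (y i) * norm (v i) - e / 2 * ((norm (v i))\<^sup>2 - 1)"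
      using norm_cauchy_schwarz[of "y i" "v i"] by simp
    also have "\<dots> \<le> w i * (norm (y i))\<^sup>2 / 2 + inverse (w i) / 2"
      using contraction_row[OF V U, of i] w[of i] by (intro j_eps_young) (auto simp: v_def)
    finally show "y i \<bullet> v i - e / 2 * ((norm (v i))\<^sup>2 - 1) \<le> w i * (norm (y i))\<^sup>2 / 2 + inverse (w i) / 2" .
  qed
  also have "\<dots> = ((U ** diag_mat w ** cadj U ** Y) \<bullet> Y) / 2 + (\<Sum>i\<in>UNIV. inverse (w i)) / 2"
    by (simp add: quadform_spectral[OF U] y_def sum.distrib sum_divide_distrib)
  finally show ?thesis .
qed

text \<open>The majorant with the weights of \<open>X\<close> is exact at \<open>X\<close>, by
  \<open>j_eps_young_eq\<close>; subtracting this equality removes the constant term.\<close>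

lemma J_eps_descent:
  fixes X Y :: "complex^'p^'n"
  assumes e: "0 < e" and W: "W = irls_weight X e"
  shows "J_eps e Y \<le> J_eps e X + ((W ** Y) \<bullet> Y - (W ** X) \<bullet> X) / 2"
proof -
  obtain U a where U: "unitary_mat U" "X ** cadj X = U ** diag_mat a ** cadj U"
    using gram_spectral by blast
  define w where "w = (\<lambda>j. inverse (max (sqrt (a j)) e))"
  have W': "W = U ** diag_mat w ** cadj U" by (simp add: W irls_weight_spectral[OF U] w_def)
  have a: "(norm ((cadj U ** X) $ i))\<^sup>2 = a i" for i by (simp add: gram_eigenvalue[OF U])
  have "J_eps e Y \<le> ((W ** Y) \<bullet> Y) / 2 + (\<Sum>i\<in>UNIV. inverse (w i)) / 2"
    unfolding W' using e U(1) weight_mult_bounds(2)[of e "sqrt (a i)" for i] gram_eigenvalue_nonneg[OF U]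
    by (intro J_eps_majorization) (auto simp: w_def max.commute less_max_iff_disj)
  moreover have "J_eps e X = ((W ** X) \<bullet> X) / 2 + (\<Sum>i\<in>UNIV. inverse (w i)) / 2"
  proof -
    have "J_eps e X = (\<Sum>i\<in>UNIV. w i * a i / 2 + inverse (w i) / 2)"
      unfolding J_eps_spectral[OF U]
      using e gram_eigenvalue_nonneg[OF U] by (intro sum.cong) (auto simp: j_eps_young_eq w_def)
    then show ?thesis
      unfolding W' quadform_spectral[OF U(1)] a by (simp add: sum.distrib sum_divide_distrib)
  qed
  ultimately show ?thesis by (simp add: diff_divide_distrib)
qed

text \<open>\<open>G\<close> is Hermitian and idempotent, so \<open>c v* V\<close> and
  \<open>c v* G\<close> have the same norm, and an orthogonal projection does not increase
  norms.\<close>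

lemma contraction_idempotent:
  assumes "V ** cadj V = G" "G ** G = G"
  shows "contraction V"
  unfolding contraction_def
proof
  fix c
  have G: "cadj G = G" using assms(1) by (metis cadj_cadj cadj_mult)
  have "(norm (c v* V))\<^sup>2 = (c v* G) \<bullet> c"
    unfolding power2_norm_eq_inner using inner_vm_adj[of "c v* V" "cadj V" c]
    by (simp add: vector_matrix_mul_assoc assms(1))
  moreover have "(norm (c v* G))\<^sup>2 = (c v* G) \<bullet> c"
    unfolding power2_norm_eq_inner using inner_vm_adj[of "c v* G" G c]
    by (simp add: vector_matrix_mul_assoc assms(2) G)
  ultimately have "norm (c v* V) = norm (c v* G)" by (metis norm_ge_zero power2_eq_imp_eq)
  have "norm (c v* G) * norm (c v* G) \<le> norm (c v* G) * norm c"
    using norm_cauchy_schwarz[of "c v* G" c] \<open>(norm (c v* G))\<^sup>2 = _\<close> by (simp add: power2_eq_square)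
  then have "norm (c v* G) \<le> norm c"
    by (metis mult_le_cancel_left_pos norm_ge_zero order_less_le)
  then show "norm (c v* V) \<le> norm c" using \<open>norm (c v* V) = _\<close> by simp
qed

text \<open>The polar factors \<open>V1\<close> and \<open>V2\<close> of \<open>X\<close> and
  \<open>Y\<close> have mutually orthogonal row spaces and column spaces. Hence
  \<open>V1 + V2\<close> is a contraction, and its pairing with \<open>X + Y\<close> is the sum of
  the two norms.\<close>

lemma nuclear_norm_orthogonal:
  fixes X Y :: "complex^'p^'n"
  assumes XY: "X ** cadj Y = 0" "cadj X ** Y = 0"
  shows "nuclear_norm X + nuclear_norm Y \<le> nuclear_norm (X + Y)"
proof -
  \<comment> \<open>\<open>F\<close> is the pseudoinverse of the positive square root of
    \<open>Z ** cadj Z\<close>, so \<open>F ** Z\<close> is the polar factor. The form with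
    \<open>H\<close> shows that its columns are combinations of columns of \<open>Z\<close>, so that
    \<open>cadj X ** Y = 0\<close> carries over.\<close>
  have polar: "\<exists>F H. cadj F = F \<and> F ** Z = Z ** cadj Z ** H ** Z \<and> Z \<bullet> (F ** Z) = nuclear_norm Z \<and>
      (F ** Z) ** cadj (F ** Z) ** ((F ** Z) ** cadj (F ** Z)) = (F ** Z) ** cadj (F ** Z)"
    for Z :: "complex^'p^'n"
  proof -
    obtain U a where U: "unitary_mat U" "Z ** cadj Z = U ** diag_mat a ** cadj U"
      using gram_spectral by blast
    define w where "w = (\<lambda>j. inverse (max (sqrt (a j)) 0))"
    define F where "F = U ** diag_mat w ** cadj U"
    define H where "H = U ** diag_mat (\<lambda>j. w j * inverse (a j)) ** cadj U"
    have F: "F = irls_weight Z 0" by (simp add: F_def irls_weight_spectral[OF U] w_def)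
    have a: "0 \<le> a j" for j by (rule gram_eigenvalue_nonneg[OF U])
    have "F = Z ** cadj Z ** H"
    proof -
      have "w j = a j * (w j * inverse (a j))" for j
        using a[of j] by (cases "a j = 0") (auto simp: w_def)
      then have "F = U ** (diag_mat a ** diag_mat (\<lambda>j. w j * inverse (a j))) ** cadj U"
        unfolding F_def diag_mat_mult by presburger
      then show ?thesis using U(1) by (simp add: U(2) H_def flip: matrix_mul_assoc)
    qed
    moreover have "(F ** Z) ** cadj (F ** Z) = U ** diag_mat (\<lambda>i. (w i)\<^sup>2 * a i) ** cadj U"
      by (rule spectral_gram[OF U]) (simp add: F_def)
    moreover have "(U ** diag_mat (\<lambda>i. (w i)\<^sup>2 * a i) ** cadj U) ** (U ** diag_mat (\<lambda>i. (w i)\<^sup>2 * a i) ** cadj U)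
       = U ** diag_mat (\<lambda>i. (w i)\<^sup>2 * a i) ** cadj U"
    proof -
      \<comment> \<open>Since \<open>inverse 0 = 0\<close>, the eigenvalues of the Gram matrix are 0
        or 1, which makes it a projection.\<close>
      have "(w i)\<^sup>2 * a i = (if a i = 0 then 0 else 1)" for i
        using a[of i] by (auto simp: w_def power_inverse)
      then have "((w i)\<^sup>2 * a i) * ((w i)\<^sup>2 * a i) = (w i)\<^sup>2 * a i" for i by simp
      then have idem: "diag_mat (\<lambda>i. (w i)\<^sup>2 * a i) ** diag_mat (\<lambda>i. (w i)\<^sup>2 * a i) = diag_mat (\<lambda>i. (w i)\<^sup>2 * a i)"
        unfolding diag_mat_mult by presburger
      have "(U ** D ** cadj U) ** (U ** D ** cadj U) = U ** (D ** D) ** cadj U" for D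
        using U(1) by (simp flip: matrix_mul_assoc)
      then show ?thesis by (simp only: idem)
    qed
    moreover have "cadj F = F" by (simp add: F_def cadj_mult matrix_mul_assoc)
    moreover have "Z \<bullet> (F ** Z) = nuclear_norm Z" by (simp add: F nuclear_norm_dual_eq)
    ultimately show ?thesis by (intro exI[of _ F] exI[of _ H]) (simp only: simp_thms)
  qed
  obtain F1 H1 where 1: "cadj F1 = F1" "F1 ** X = X ** cadj X ** H1 ** X" "X \<bullet> (F1 ** X) = nuclear_norm X"
    "(F1 ** X) ** cadj (F1 ** X) ** ((F1 ** X) ** cadj (F1 ** X)) = (F1 ** X) ** cadj (F1 ** X)"
    using polar[of X] by blast
  obtain F2 H2 where 2: "cadj F2 = F2" "F2 ** Y = Y ** cadj Y ** H2 ** Y" "Y \<bullet> (F2 ** Y) = nuclear_norm Y"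
    "(F2 ** Y) ** cadj (F2 ** Y) ** ((F2 ** Y) ** cadj (F2 ** Y)) = (F2 ** Y) ** cadj (F2 ** Y)"
    using polar[of Y] by blast
  have YX: "Y ** cadj X = 0" "cadj Y ** X = 0"
    using XY by (metis cadj_cadj cadj_mult cadj_zero)+
  define V1 V2 where "V1 = F1 ** X" and "V2 = F2 ** Y"
  have cross: "V1 ** cadj V2 = 0" "V2 ** cadj V1 = 0" "cadj V1 ** V2 = 0" "cadj V2 ** V1 = 0"
  proof -
    have "V1 ** cadj V2 = F1 ** (X ** cadj Y) ** cadj F2"
      by (simp add: V1_def V2_def cadj_mult matrix_mul_assoc)
    then show c1: "V1 ** cadj V2 = 0" by (simp add: XY)
    have "cadj V1 ** V2 = cadj X ** cadj H1 ** X ** (cadj X ** Y) ** cadj Y ** H2 ** Y"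
      unfolding V1_def V2_def 1(2) 2(2) by (simp add: cadj_mult matrix_mul_assoc)
    then show c2: "cadj V1 ** V2 = 0" by (simp add: XY)
    show "V2 ** cadj V1 = 0" "cadj V2 ** V1 = 0"
      using c1 c2 by (metis cadj_cadj cadj_mult cadj_zero)+
  qed
  have "contraction (V1 + V2)"
  proof (rule contraction_idempotent[OF refl])
    have G: "(V1 + V2) ** cadj (V1 + V2) = V1 ** cadj V1 + V2 ** cadj V2"
      by (simp add: cadj_add matrix_add_ldistrib matrix_mult_add_rdistrib cross)
    have "V1 ** cadj V1 ** (V2 ** cadj V2) = V1 ** (cadj V1 ** V2) ** cadj V2"
      "V2 ** cadj V2 ** (V1 ** cadj V1) = V2 ** (cadj V2 ** V1) ** cadj V1"
      by (simp_all add: matrix_mul_assoc)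
    then show "(V1 + V2) ** cadj (V1 + V2) ** ((V1 + V2) ** cadj (V1 + V2)) = (V1 + V2) ** cadj (V1 + V2)"
      unfolding G using 1(4) 2(4)
      by (simp add: matrix_add_ldistrib matrix_mult_add_rdistrib cross flip: V1_def V2_def)
  qed
  from nuclear_norm_dual[OF this, of "X + Y"]
  have "X \<bullet> V1 + Y \<bullet> V2 + (X \<bullet> V2 + Y \<bullet> V1) \<le> nuclear_norm (X + Y)"
    by (simp add: inner_add_left inner_add_right)
  \<comment> \<open>Rows of \<open>F ** B\<close> are combinations of rows of \<open>B\<close>; this
    removes the mixed terms \<open>X \<bullet> V2\<close> and \<open>Y \<bullet> V1\<close>.\<close>
  moreover have orth: "A \<bullet> (F ** B) = 0" if "A ** cadj B = 0" for A B :: "complex^'p^'n" and F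
  proof -
    have "hinner (A $ i) (B $ j) = 0" for i j
      using that by (simp flip: mult_cadj_nth)
    moreover have "hinner (A $ i) ((F ** B) $ i) = (\<Sum>j\<in>UNIV. cnj (F $ i $ j) * hinner (A $ i) (B $ j))" for i
    proof -
      have "hinner (A $ i) ((F ** B) $ i) = (\<Sum>k\<in>UNIV. \<Sum>j\<in>UNIV. cnj (F $ i $ j) * (A $ i $ k * cnj (B $ j $ k)))"
        by (simp add: hinner_def matrix_matrix_mult_def sum_distrib_left mult.left_commute)
      also have "\<dots> = (\<Sum>j\<in>UNIV. \<Sum>k\<in>UNIV. cnj (F $ i $ j) * (A $ i $ k * cnj (B $ j $ k)))"
        by (rule sum.swap)
      finally show ?thesis by (simp add: hinner_def sum_distrib_left)
    qed
    ultimately have "(A $ i) \<bullet> ((F ** B) $ i) = 0" for i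
      by (simp flip: Re_hinner)
    then show ?thesis by (simp add: inner_rows)
  qed
  ultimately show ?thesis
    using 1(3) 2(3) orth[OF XY(1)] orth[OF YX(1)] by (simp add: V1_def V2_def)
qed

section \<open>Low rank approximation and the null space property\<close>

lemma norm_sq_vm_unitary:
  assumes "unitary_mat U"
  shows "(norm c)\<^sup>2 = (\<Sum>m\<in>UNIV. (norm ((c v* U) $ m))\<^sup>2)"
proof -
  have "(norm c)\<^sup>2 = (norm (c v* U))\<^sup>2" by (simp add: unitary_norm_vm[OF assms])
  then show ?thesis by (simp add: norm_vec_def L2_set_def sum_nonneg)
qed

text \<open>The coordinates of \<open>c\<close> at the \<open>i - 1\<close> largest singular values
  vanish, and each remaining one is at most \<open>sing_val X i\<close>. This and the next lemma are
  the two halves of the min-max principle.\<close>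

lemma norm_vm_le_sing_val:
  fixes X :: "complex^'p^'n"
  assumes U: "unitary_mat U" "X ** cadj X = U ** diag_mat (\<lambda>j. (sing_val X (index_no j))\<^sup>2) ** cadj U"
    and i: "1 \<le> i" and c: "\<And>m. index_no m < i \<Longrightarrow> (c v* U) $ m = 0"
  shows "norm (c v* X) \<le> sing_val X i * norm c"
proof -
  have "(norm (c v* X))\<^sup>2 \<le> (\<Sum>m\<in>UNIV. (sing_val X i)\<^sup>2 * (norm ((c v* U) $ m))\<^sup>2)"
    unfolding norm_vm_gram[OF U(2)]
  proof (rule sum_mono)
    fix m
    show "(sing_val X (index_no m))\<^sup>2 * (norm ((c v* U) $ m))\<^sup>2 \<le> (sing_val X i)\<^sup>2 * (norm ((c v* U) $ m))\<^sup>2"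
    proof (cases "index_no m < i")
      case False
      then show ?thesis
        using i by (intro mult_right_mono power_mono sing_val_antimono sing_val_nonneg) auto
    qed (simp add: c)
  qed
  also have "\<dots> = (sing_val X i * norm c)\<^sup>2"
    by (simp add: norm_sq_vm_unitary[OF U(1), of c] power_mult_distrib sum_distrib_left)
  finally show ?thesis
    by (rule power2_le_imp_le) (simp add: sing_val_nonneg)
qed

lemma sing_val_le_norm_vm:
  fixes X :: "complex^'p^'n"
  assumes U: "unitary_mat U" "X ** cadj X = U ** diag_mat (\<lambda>j. (sing_val X (index_no j))\<^sup>2) ** cadj U"
    and c: "\<And>m. i < index_no m \<Longrightarrow> (c v* U) $ m = 0"
  shows "sing_val X i * norm c \<le> norm (c v* X)"
proof -
  have "(sing_val X i * norm c)\<^sup>2 = (\<Sum>m\<in>UNIV. (sing_val X i)\<^sup>2 * (norm ((c v* U) $ m))\<^sup>2)"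
    by (simp add: norm_sq_vm_unitary[OF U(1), of c] power_mult_distrib sum_distrib_left)
  also have "\<dots> \<le> (norm (c v* X))\<^sup>2"
    unfolding norm_vm_gram[OF U(2)]
  proof (rule sum_mono)
    fix m
    show "(sing_val X i)\<^sup>2 * (norm ((c v* U) $ m))\<^sup>2 \<le> (sing_val X (index_no m))\<^sup>2 * (norm ((c v* U) $ m))\<^sup>2"
    proof (cases "i < index_no m")
      case False
      then show ?thesis
        by (intro mult_right_mono power_mono sing_val_antimono sing_val_nonneg) (use index_no_range[of m] in auto)
    qed (simp add: c)
  qed
  finally show ?thesis by (rule power2_le_imp_le) simp
qed

text \<open>Every row of \<open>Z\<close> is a combination of at most \<open>j\<close> basis rows.
  The vectors in \<open>B\<close> collect the coefficients of each basis row, so the conditions on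
  \<open>c\<close> cancel every contribution to \<open>c v* Z\<close>.\<close>

lemma rank_annihilator:
  fixes Z :: "complex^'p^'n"
  assumes "rank Z \<le> j"
  shows "\<exists>B. finite B \<and> card B \<le> j \<and>
    (\<forall>c. (\<forall>b\<in>B. (\<Sum>i\<in>UNIV. c $ i * b $ i) = 0) \<longrightarrow> c v* Z = 0)"
proof -
  obtain R where R: "R \<subseteq> rows Z" "rows Z \<subseteq> vec.span R" "card R = vec.dim (rows Z)" "vec.independent R"
    using vec.basis_exists[of "rows Z"] by metis
  have fin: "finite R" using R(4) by (rule vec.finiteI_independent)
  have "\<exists>u. Z $ i = (\<Sum>r\<in>R. u r *s r)" for i
  proof -
    have "Z $ i \<in> rows Z" by (auto simp: rows_def row_def vec_lambda_eta)
    then have "Z $ i \<in> vec.span R" using R(2) by blast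
    then show ?thesis unfolding vec.span_finite[OF fin] by blast
  qed
  then obtain u where u: "\<And>i. Z $ i = (\<Sum>r\<in>R. u i r *s r)" by metis
  define B where "B = (\<lambda>r. \<chi> i. u i r) ` R"
  have "c v* Z = 0" if "\<forall>b\<in>B. (\<Sum>i\<in>UNIV. c $ i * b $ i) = 0" for c
  proof -
    have "(c v* Z) $ k = 0" for k
    proof -
      have "(c v* Z) $ k = (\<Sum>i\<in>UNIV. \<Sum>r\<in>R. r $ k * (c $ i * u i r))"
        by (simp add: vector_matrix_mult_def u sum_distrib_left sum_distrib_right algebra_simps)
      also have "\<dots> = (\<Sum>r\<in>R. r $ k * (\<Sum>i\<in>UNIV. c $ i * u i r))"
        by (subst sum.swap) (simp add: sum_distrib_left)
      also have "\<dots> = 0" using that by (auto simp: B_def)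
      finally show ?thesis .
    qed
    then show ?thesis by (simp add: vec_eq_iff)
  qed
  moreover have "card B \<le> j"
    unfolding B_def using card_image_le[OF fin] R(3) assms by (metis order_trans row_rank_def_gen)
  ultimately show ?thesis using fin by (intro exI[of _ B]) (auto simp: B_def)
qed

lemma card_index_no:
  assumes "T \<subseteq> {1..CARD('n)}"
  shows "card {m :: 'n::finite. index_no m \<in> T} = card T"
proof -
  have "bij_betw index_no {m :: 'n. index_no m \<in> T} T"
    using bij_index_no[where 'n='n] assms unfolding bij_betw_def
    by (auto intro: inj_on_subset)
  then show ?thesis by (rule bij_betw_same_card)
qed

lemma vm_nth_column: "(c v* U) $ m = (\<Sum>i\<in>UNIV. c $ i * column m U $ i)"
  by (simp add: vector_matrix_mult_def column_def mult.commute)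

text \<open>
  The vector \<open>c\<close> lies in an intersection of three subspaces whose codimensions
  \<open>CARD('n) - (i + j)\<close>, \<open>j\<close> and \<open>i - 1\<close> add up to less than \<open>CARD('n)\<close>.
\<close>

theorem sing_val_weyl:
  fixes X Z :: "complex^'p^'n"
  assumes i: "1 \<le> i" and Z: "rank Z \<le> j"
  shows "sing_val X (i + j) \<le> sing_val (X - Z) i"
proof (cases "i + j \<le> CARD('n)")
  case False
  then show ?thesis by (simp add: sing_val_def[of X] sing_val_nonneg)
next
  case True
  obtain U where U: "unitary_mat U"
    "X ** cadj X = U ** diag_mat (\<lambda>j. (sing_val X (index_no j))\<^sup>2) ** cadj U"
    using svd_gram by blast
  obtain V where V: "unitary_mat V"
    "(X - Z) ** cadj (X - Z) = V ** diag_mat (\<lambda>j. (sing_val (X - Z) (index_no j))\<^sup>2) ** cadj V"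
    using svd_gram by blast
  obtain B where B: "finite B" "card B \<le> j"
    "\<And>c. (\<forall>b\<in>B. (\<Sum>i\<in>UNIV. c $ i * b $ i) = 0) \<Longrightarrow> c v* Z = 0"
    using rank_annihilator[OF Z] by blast
  define P where "P = (\<lambda>m. column m U) ` {m. index_no m \<in> {i + j<..CARD('n)}}"
  define Q where "Q = (\<lambda>m. column m V) ` {m. index_no m \<in> {1..<i}}"
  have "card P \<le> card {i + j<..CARD('n)}"
    unfolding P_def by (subst card_index_no[symmetric, where 'n='n]) (auto intro!: card_image_le)
  moreover have "card Q \<le> card {1..<i}"
    unfolding Q_def by (subst card_index_no[symmetric, where 'n='n]) (use True in \<open>auto intro!: card_image_le\<close>)
  moreover have "card (P \<union> (B \<union> Q)) \<le> card P + (card B + card Q)"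
    by (meson card_Un_le order_trans add_left_mono)
  ultimately have "card (P \<union> (B \<union> Q)) < CARD('n)" using B(2) True i by simp
  moreover have "finite (P \<union> (B \<union> Q))" using B(1) by (simp add: P_def Q_def)
  ultimately obtain c where c: "c \<noteq> 0" "\<And>b. b \<in> P \<union> (B \<union> Q) \<Longrightarrow> (\<Sum>i\<in>UNIV. c $ i * b $ i) = 0"
    using finite_nonzero_annihilator by metis
  have "sing_val X (i + j) * norm c \<le> norm (c v* X)"
  proof (rule sing_val_le_norm_vm[OF U])
    fix m :: 'n assume "i + j < index_no m"
    then have "column m U \<in> P" using index_no_range[of m] by (auto simp: P_def)
    then show "(c v* U) $ m = 0" using c(2) by (simp add: vm_nth_column)
  qed
  also have "c v* X = c v* (X - Z)"
    using B(3) c(2) by (simp add: vector_matrix_mult_diff_rdistrib)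
  also have "norm (c v* (X - Z)) \<le> sing_val (X - Z) i * norm c"
  proof (rule norm_vm_le_sing_val[OF V i])
    fix m :: 'n assume "index_no m < i"
    then have "column m V \<in> Q" using index_no_range[of m] by (auto simp: Q_def)
    then show "(c v* V) $ m = 0" using c(2) by (simp add: vm_nth_column)
  qed
  finally show ?thesis using c(1) by simp
qed

text \<open>By Weyl's inequality, each of the first \<open>J - k\<close> singular values of
  \<open>X - Z\<close> is at least \<open>sing_val X J\<close>.\<close>

lemma sing_val_le_rank_distance:
  fixes X Z :: "complex^'p^'n"
  assumes Z: "rank Z \<le> k" and J: "k \<le> J"
  shows "real (J - k) * sing_val X J \<le> nuclear_norm (X - Z)"
proof (cases "J \<le> CARD('n)")
  case False
  then show ?thesis by (simp add: sing_val_def nuclear_norm_nonneg)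
next
  case True
  have "real (J - k) * sing_val X J = (\<Sum>i=1..J - k. sing_val X J)" by simp
  also have "\<dots> \<le> (\<Sum>i=1..J - k. sing_val (X - Z) i)"
  proof (rule sum_mono)
    fix i assume i: "i \<in> {1..J - k}"
    then have "sing_val X J \<le> sing_val X (i + k)" by (intro sing_val_antimono) auto
    also have "\<dots> \<le> sing_val (X - Z) i" using i by (intro sing_val_weyl Z) auto
    finally show "sing_val X J \<le> sing_val (X - Z) i" .
  qed
  also have "\<dots> \<le> nuclear_norm (X - Z)"
    unfolding nuclear_norm_def using True by (intro sum_mono2) (auto simp: sing_val_nonneg)
  finally show ?thesis .
qed

text \<open>\<open>Z\<close> truncates the singular value decomposition after \<open>k\<close>
  terms; no singular value of the residual exceeds \<open>sing_val X (k + 1)\<close>.\<close>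

lemma low_rank_truncation:
  fixes X :: "complex^'p^'n"
  shows "\<exists>Z. rank Z \<le> k \<and> nuclear_norm (X - Z) \<le> real CARD('n) * sing_val X (k + 1)"
proof -
  obtain U where U: "unitary_mat U"
    "X ** cadj X = U ** diag_mat (\<lambda>j. (sing_val X (index_no j))\<^sup>2) ** cadj U"
    using svd_gram by blast
  define Y where "Y = cadj U ** X"
  define d where "d = (\<lambda>m :: 'n. if index_no m \<le> k then 1 else 0 :: real)"
  define Z where "Z = U ** diag_mat d ** Y"
  have "X = U ** diag_mat (\<lambda>_. 1) ** cadj U ** X"
    using U(1) by (simp add: diag_mat_one unitary_cadj_mult)
  moreover have "diag_mat (\<lambda>_. 1) - diag_mat d = diag_mat (\<lambda>m. 1 - d m)"
    by (simp add: vec_eq_iff diag_mat_def)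
  ultimately have XZ: "X - Z = U ** diag_mat (\<lambda>m. 1 - d m) ** cadj U ** X"
    unfolding Z_def Y_def by (metis matrix_diff_ldistrib matrix_diff_rdistrib matrix_mul_assoc)
  have "nuclear_norm (X - Z) = (\<Sum>m\<in>UNIV. sqrt ((1 - d m)\<^sup>2 * (sing_val X (index_no m))\<^sup>2))"
    by (rule nuclear_norm_spectral[OF U(1) spectral_gram[OF U XZ]])
  also have "\<dots> \<le> (\<Sum>m\<in>(UNIV :: 'n set). sing_val X (k + 1))"
    by (intro sum_mono) (auto simp: d_def sing_val_nonneg intro!: sing_val_antimono)
  finally have "nuclear_norm (X - Z) \<le> real CARD('n) * sing_val X (k + 1)" by simp
  moreover have "rank Z \<le> k"
  proof -
    define R where "R = (\<lambda>m. Y $ m) ` {m. index_no m \<in> {1..min k CARD('n)}}"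
    have fin: "finite R" by (simp add: R_def)
    have "card R \<le> card {1..min k CARD('n)}"
      unfolding R_def by (subst card_index_no[symmetric, where 'n='n]) (auto intro!: card_image_le)
    have "rows Z \<subseteq> vec.span R"
    proof
      fix z assume "z \<in> rows Z"
      then obtain i where z: "z = Z $ i" by (auto simp: rows_def row_def vec_lambda_eta)
      have "Z $ i = (\<Sum>m\<in>UNIV. (U $ i $ m * complex_of_real (d m)) *s (Y $ m))"
        by (simp add: vec_eq_iff Z_def matrix_matrix_mult_def[of _ Y] mult_diag_nth mult.commute)
      also have "\<dots> \<in> vec.span R"
      proof (rule vec.span_sum)
        fix m
        show "(U $ i $ m * complex_of_real (d m)) *s (Y $ m) \<in> vec.span R"
        proof (cases "index_no m \<le> k")
          case True
          then have "Y $ m \<in> R" using index_no_range[of m] by (auto simp: R_def)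
          then show ?thesis by (intro vec.span_scale vec.span_base)
        qed (simp add: d_def vec.span_zero)
      qed
      finally show "z \<in> vec.span R" by (simp add: z)
    qed
    then have "rank Z \<le> card R" unfolding row_rank_def_gen using fin by (rule vec.dim_le_card)
    then show ?thesis using \<open>card R \<le> _\<close> by simp
  qed
  ultimately show ?thesis by blast
qed

lemma rank_le_sing_val:
  fixes X :: "complex^'p^'n"
  shows "rank X \<le> k \<longleftrightarrow> sing_val X (k + 1) = 0"
proof
  assume "rank X \<le> k"
  from sing_val_le_rank_distance[OF this, of "k + 1" X]
  show "sing_val X (k + 1) = 0" using sing_val_nonneg[of X "k + 1"] by simp
next
  assume 0: "sing_val X (k + 1) = 0"
  obtain Z where Z: "rank Z \<le> k" "nuclear_norm (X - Z) \<le> real CARD('n) * sing_val X (k + 1)"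
    using low_rank_truncation by blast
  have "nuclear_norm (X - Z) \<le> 0" using Z(2) unfolding 0 by simp
  then have "X - Z = 0" by (rule nuclear_norm_eq_0)
  then show "rank X \<le> k" using Z(1) by simp
qed

text \<open>Instead of continuity of singular values, \<open>L\<close> is compared with a truncation
  of \<open>X l\<close>: the distance from \<open>L\<close> to this matrix of rank at most
  \<open>k\<close> tends to 0 and bounds \<open>sing_val L (k + 1)\<close>.\<close>

lemma rank_limit_le:
  fixes X :: "nat \<Rightarrow> complex^'p^'n"
  assumes lim: "X \<longlonglongrightarrow> L" and sv: "(\<lambda>l. sing_val (X l) (k + 1)) \<longlonglongrightarrow> 0"
  shows "rank L \<le> k"
proof -
  have "sing_val L (k + 1) \<le> real CARD('n) * norm (L - X l) + real CARD('n) * sing_val (X l) (k + 1)" for l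
  proof -
    obtain Z where Z: "rank Z \<le> k" "nuclear_norm (X l - Z) \<le> real CARD('n) * sing_val (X l) (k + 1)"
      using low_rank_truncation by blast
    have "sing_val L (k + 1) \<le> nuclear_norm (L - Z)"
      using sing_val_le_rank_distance[OF Z(1), of "k + 1" L] by simp
    also have "\<dots> \<le> nuclear_norm (L - X l) + nuclear_norm (X l - Z)" by (rule nuclear_norm_triangle_diff)
    finally show ?thesis using Z(2) nuclear_norm_le_norm[of "L - X l"] by linarith
  qed
  moreover have "(\<lambda>l. real CARD('n) * norm (L - X l) + real CARD('n) * sing_val (X l) (k + 1)) \<longlonglongrightarrow> 
    real CARD('n) * norm (L - L) + real CARD('n) * 0"
    by (intro tendsto_intros lim sv)
  ultimately have "sing_val L (k + 1) \<le> 0"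
    by (intro LIMSEQ_le_const) auto
  then show ?thesis using sing_val_nonneg[of L "k + 1"] by (simp add: rank_le_sing_val)
qed

lemma rank_zero: "rank (0 :: complex^'p^'n) \<le> k"
proof -
  have "rows (0 :: complex^'p^'n) \<subseteq> vec.span {}"
    by (auto simp: rows_def row_def vec_eq_iff)
  then have "vec.dim (rows (0 :: complex^'p^'n)) \<le> card ({} :: (complex^'p) set)"
    by (rule vec.dim_le_card) simp
  then show ?thesis unfolding row_rank_def_gen card.empty by linarith
qed

section \<open>Best approximation error and the null space property\<close>

lemma best_rank_error_le: "rank Z \<le> k \<Longrightarrow> best_rank_error k X \<le> nuclear_norm (X - Z)"
  unfolding best_rank_error_def
  by (rule cInf_lower) (auto intro!: bdd_belowI[of _ 0] simp: nuclear_norm_nonneg)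

lemma best_rank_error_greatest:
  assumes "\<And>Z. rank Z \<le> k \<Longrightarrow> b \<le> nuclear_norm (X - Z)"
  shows "b \<le> best_rank_error k X"
  unfolding best_rank_error_def
  by (rule cInf_greatest) (use assms rank_zero in blast)+

lemma best_rank_error_nonneg: "0 \<le> best_rank_error k X"
  by (rule best_rank_error_greatest) (rule nuclear_norm_nonneg)

lemma best_rank_error_triangle: "best_rank_error k X \<le> nuclear_norm (X - Y) + best_rank_error k Y"
  for X Y :: "complex^'p^'n"
proof -
  have "best_rank_error k X - nuclear_norm (X - Y) \<le> best_rank_error k Y"
  proof (rule best_rank_error_greatest)
    fix Z :: "complex^'p^'n" assume "rank Z \<le> k"
    then show "best_rank_error k X - nuclear_norm (X - Y) \<le> nuclear_norm (Y - Z)"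
      using best_rank_error_le[of Z k X] nuclear_norm_triangle_diff[of X Z Y] by linarith
  qed
  then show ?thesis by simp
qed

lemma sing_val_le_best_rank_error:
  "k \<le> J \<Longrightarrow> real (J - k) * sing_val X J \<le> best_rank_error k X"
  by (intro best_rank_error_greatest sing_val_le_rank_distance)

text \<open>The null space property is applied to \<open>Y - X\<close> with \<open>X1 = Z\<close>,
  an approximant of \<open>X\<close>. As \<open>H2\<close> is orthogonal to \<open>Z\<close> on both
  sides, their norms add up, which bounds \<open>H2\<close> and hence \<open>Y - X\<close>.\<close>

lemma srnsp_distance_rank:
  assumes srnsp: "srnsp S K \<eta>" and ker: "S (Y - X) = 0" and Z: "rank Z \<le> K"
  shows "nuclear_norm (Y - X) \<le>
    (1 + \<eta>) / (1 - \<eta>) * (nuclear_norm Y - nuclear_norm X + 2 * nuclear_norm (X - Z))"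
proof (cases "Y - X = 0")
  case True
  then have "Y = X" by simp
  then show ?thesis using srnsp by (simp add: srnsp_def nuclear_norm_nonneg)
next
  case False
  have eta: "0 < \<eta>" "\<eta> < 1" using srnsp by (auto simp: srnsp_def)
  have "Y - X = Z + (Y - X - Z)" by simp
  then obtain H1 H2 where H: "Y - X = H1 + H2" "Z ** cadj H2 = 0" "cadj Z ** H2 = 0"
    "nuclear_norm H1 \<le> \<eta> * nuclear_norm H2"
    using srnsp ker False Z unfolding srnsp_def by metis
  have "nuclear_norm Z + nuclear_norm H2 \<le> nuclear_norm (Z + H2)"
    by (rule nuclear_norm_orthogonal[OF H(2,3)])
  also have "Z + H2 = Y - (H1 + (X - Z))" using H(1) by (simp add: algebra_simps)
  also have "nuclear_norm \<dots> \<le> nuclear_norm Y + nuclear_norm (H1 + (X - Z))"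
    using nuclear_norm_triangle[of Y "- (H1 + (X - Z))"] by (simp only: nuclear_norm_minus flip: diff_conv_add_uminus)
  also have "nuclear_norm (H1 + (X - Z)) \<le> nuclear_norm H1 + nuclear_norm (X - Z)"
    by (rule nuclear_norm_triangle)
  finally have "nuclear_norm Z + nuclear_norm H2 \<le> nuclear_norm Y + nuclear_norm H1 + nuclear_norm (X - Z)"
    by simp
  moreover have "nuclear_norm X \<le> nuclear_norm Z + nuclear_norm (X - Z)"
    using nuclear_norm_triangle[of Z "X - Z"] by simp
  ultimately have "(1 - \<eta>) * nuclear_norm H2 \<le> nuclear_norm Y - nuclear_norm X + 2 * nuclear_norm (X - Z)"
    using H(4) by (simp add: algebra_simps)
  then have "nuclear_norm H2 \<le> (nuclear_norm Y - nuclear_norm X + 2 * nuclear_norm (X - Z)) / (1 - \<eta>)"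
    using eta by (simp add: field_simps)
  then have "(1 + \<eta>) * nuclear_norm H2 \<le>
      (1 + \<eta>) * ((nuclear_norm Y - nuclear_norm X + 2 * nuclear_norm (X - Z)) / (1 - \<eta>))"
    using eta by (intro mult_left_mono) auto
  moreover have "nuclear_norm (Y - X) \<le> (1 + \<eta>) * nuclear_norm H2"
    using nuclear_norm_triangle[of H1 H2] H(1,4) by (simp add: algebra_simps)
  ultimately show ?thesis by simp
qed

theorem srnsp_distance:
  fixes X Y :: "complex^'p^'n"
  assumes srnsp: "srnsp S K \<eta>" and ker: "S (Y - X) = 0" and k: "k \<le> K"
  shows "nuclear_norm (Y - X) \<le>
    (1 + \<eta>) / (1 - \<eta>) * (nuclear_norm Y - nuclear_norm X + 2 * best_rank_error k X)"
proof -
  have eta: "0 < \<eta>" "\<eta> < 1" using srnsp by (auto simp: srnsp_def)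
  \<comment> \<open>The rank estimate is solved for the approximation error of \<open>Z\<close>, so
    that the infimum over \<open>Z\<close> can be taken.\<close>
  have "(nuclear_norm (Y - X) / ((1 + \<eta>) / (1 - \<eta>)) - nuclear_norm Y + nuclear_norm X) / 2
      \<le> best_rank_error k X"
  proof (rule best_rank_error_greatest)
    fix Z :: "complex^'p^'n" assume "rank Z \<le> k"
    then have "rank Z \<le> K" using k by simp
    from srnsp_distance_rank[of S K \<eta> Y X, OF srnsp ker this]
    have "nuclear_norm (Y - X) / ((1 + \<eta>) / (1 - \<eta>)) \<le>
       nuclear_norm Y - nuclear_norm X + 2 * nuclear_norm (X - Z)"
      using eta by (subst pos_divide_le_eq) (auto simp: mult.commute)
    then show "(nuclear_norm (Y - X) / ((1 + \<eta>) / (1 - \<eta>)) - nuclear_norm Y + nuclear_norm X) / 2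
      \<le> nuclear_norm (X - Z)" by simp
  qed
  then have "nuclear_norm (Y - X) / ((1 + \<eta>) / (1 - \<eta>)) \<le>
       nuclear_norm Y - nuclear_norm X + 2 * best_rank_error k X" by simp
  then show ?thesis using eta by (subst (asm) pos_divide_le_eq) (auto simp: mult.commute)
qed

section \<open>The reweighted least squares iteration\<close>

lemma quadform_lower:
  fixes w :: "'n::finite \<Rightarrow> real"
  assumes "unitary_mat U" "\<And>i. c \<le> w i"
  shows "c * (norm Y)\<^sup>2 \<le> (U ** diag_mat w ** cadj U ** Y) \<bullet> Y"
  unfolding quadform_spectral[OF assms(1)] norm_sq_unitary_rows[OF assms(1)] sum_distrib_left
  by (intro sum_mono mult_right_mono assms(2)) simp

lemma hermitian_inner: "cadj W = W \<Longrightarrow> (W ** X) \<bullet> Y = (W ** Y) \<bullet> X" for W :: "complex^'n^'n"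
  by (metis inner_commute matrix_inner_left)

lemma cadj_spectral: "cadj (U ** diag_mat w ** cadj U) = U ** diag_mat w ** cadj U"
  by (simp add: cadj_mult matrix_mul_assoc)

lemma continuous_on_matrix_mult [continuous_intros]:
  fixes A :: "complex^'m^'n"
  shows "continuous_on T (\<lambda>Y. A ** Y)"
  unfolding matrix_matrix_mult_def by (intro continuous_intros)

text \<open>Positive weights make the objective coercive, so the minimum is attained and
  \<open>arg_min\<close> denotes a true minimizer. Vanishing first variation along the kernel of
  \<open>S\<close> gives the orthogonality.\<close>

lemma weighted_least_squares:
  fixes S :: "complex^'p^'n \<Rightarrow> complex^'m" and w :: "'n \<Rightarrow> real"
  assumes lin: "linear S" and feas: "S Y0 = M"
    and U: "unitary_mat U" and w: "\<And>i. 0 < w i" and W: "W = U ** diag_mat w ** cadj U"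
    and X: "X = arg_min (\<lambda>Y. (norm (psd_sqrt W ** Y))\<^sup>2) (\<lambda>Y. S Y = M)"
  shows "S X = M" and "S H = 0 \<Longrightarrow> (W ** X) \<bullet> H = 0"
proof -
  define f where "f = (\<lambda>Y :: complex^'p^'n. (W ** Y) \<bullet> Y)"
  have f: "(norm (psd_sqrt W ** Y))\<^sup>2 = f Y" for Y :: "complex^'p^'n"
  proof -
    have "psd_sqrt W = U ** diag_mat (\<lambda>i. sqrt (w i)) ** cadj U"
      unfolding W using U w by (intro psd_sqrt_unitary_diag) (auto intro: less_imp_le)
    then show ?thesis
      unfolding f_def W quadform_spectral[OF U] norm_sq_unitary_rows[OF U]
      using w by (simp add: spectral_row[OF U] power_mult_distrib less_imp_le)
  qed
  define c where "c = Min (range w)"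
  have c: "0 < c" "\<And>i. c \<le> w i" using w by (auto simp: c_def)
  have lower: "c * (norm Y)\<^sup>2 \<le> f Y" for Y
    unfolding f_def W by (rule quadform_lower[OF U c(2)])
  \<comment> \<open>Competitors at least as good as \<open>Y0\<close> lie in this ball, so it
    suffices to minimize over the compact set \<open>T\<close>.\<close>
  define R where "R = sqrt (f Y0 / c)"
  define T where "T = cball 0 R \<inter> {Y. S Y = M}"
  have small: "Y \<in> cball 0 R" if "f Y \<le> f Y0" for Y
  proof -
    have "c * (norm Y)\<^sup>2 \<le> f Y0" using lower[of Y] that by linarith
    then have "(norm Y)\<^sup>2 \<le> f Y0 / c" using c(1) by (simp add: field_simps)
    then have "norm Y \<le> R" unfolding R_def by (rule real_le_rsqrt)
    then show ?thesis by simp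
  qed
  have "closed {Y. S Y = M}"
    using lin by (intro closed_Collect_eq linear_continuous_on continuous_on_const)
      (simp add: linear_conv_bounded_linear)
  then have "compact T" by (simp add: T_def compact_Int_closed)
  moreover have "Y0 \<in> T" using small[of Y0] feas by (simp add: T_def)
  moreover have "continuous_on T f" unfolding f_def by (intro continuous_intros)
  ultimately obtain X1 where X1: "X1 \<in> T" "\<And>Y. Y \<in> T \<Longrightarrow> f X1 \<le> f Y"
    using continuous_attains_inf[of T f] by auto
  have "f X1 \<le> f Y" if "S Y = M" for Y
  proof (cases "f Y \<le> f Y0")
    case True
    then show ?thesis using small[OF True] that by (intro X1) (simp add: T_def)
  next
    case False
    then show ?thesis using X1(2)[OF \<open>Y0 \<in> T\<close>] by simp
  qed
  then have "is_arg_min f (\<lambda>Y. S Y = M) X1"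
    using X1(1) by (auto simp: is_arg_min_linorder T_def)
  then have "is_arg_min f (\<lambda>Y. S Y = M) X"
    unfolding X f arg_min_def by (rule someI)
  then have SX: "S X = M" and min: "\<And>Y. S Y = M \<Longrightarrow> f X \<le> f Y"
    by (auto simp: is_arg_min_linorder)
  show "S X = M" by (rule SX)
  assume H: "S H = 0"
  have Wh: "cadj W = W" unfolding W by (rule cadj_spectral)
  have "- (2 * ((W ** X) \<bullet> H)) = 0"
  proof (rule linear_coeff_zero)
    fix t
    have "S (X + t *\<^sub>R H) = M" using SX H lin by (simp add: linear_add linear_scale)
    from min[OF this] have "f X \<le> f (X + t *\<^sub>R H)" .
    also have "f (X + t *\<^sub>R H) = f X + 2 * t * ((W ** X) \<bullet> H) + t\<^sup>2 * f H"
    proof -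
      have "W ** (X + t *\<^sub>R H) = W ** X + t *\<^sub>R (W ** H)"
        by (simp add: matrix_add_ldistrib matrix_matrix_mult_def vec_eq_iff scaleR_sum_right distrib_left sum.distrib)
      moreover have "(W ** H) \<bullet> X = (W ** X) \<bullet> H" by (rule hermitian_inner[OF Wh])
      ultimately show ?thesis
        by (simp add: f_def inner_add_left inner_add_right power2_eq_square algebra_simps)
    qed
    finally show "- (2 * ((W ** X) \<bullet> H)) * t + (- f H) * t\<^sup>2 \<le> 0" by (simp add: algebra_simps)
  qed
  then show "(W ** X) \<bullet> H = 0" by simp
qed

lemma irls_weight_posdef:
  assumes "0 < e"
  shows "\<exists>U w. unitary_mat U \<and> (\<forall>i. 0 < w i) \<and> irls_weight X e = U ** diag_mat w ** cadj U"
proof -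
  obtain U a where U: "unitary_mat U" "X ** cadj X = U ** diag_mat a ** cadj U"
    using gram_spectral by blast
  have "irls_weight X e = U ** diag_mat (\<lambda>j. inverse (max (sqrt (a j)) e)) ** cadj U"
    by (rule irls_weight_spectral[OF U])
  then show ?thesis using U(1) assms
    by (intro exI[of _ U] exI[of _ "\<lambda>j. inverse (max (sqrt (a j)) e)"]) auto
qed

lemma irls_weight_hermitian: "cadj (irls_weight X e) = irls_weight X e"
  by (metis cadj_spectral gram_spectral irls_weight_spectral)

text \<open>\<open>B\<close> bounds \<open>e\<close> and all singular values of \<open>X\<close>, so
  the eigenvalues of the weight are at least \<open>1 / B\<close>. This turns decrease of the energy
  into control of the step length.\<close>

lemma irls_weight_lower:
  assumes "0 < e" "e \<le> B" "norm X \<le> B"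
  shows "(norm D)\<^sup>2 / B \<le> (irls_weight X e ** D) \<bullet> D"
proof -
  obtain U a where U: "unitary_mat U" "X ** cadj X = U ** diag_mat a ** cadj U"
    using gram_spectral by blast
  have "inverse B * (norm D)\<^sup>2 \<le> (U ** diag_mat (\<lambda>j. inverse (max (sqrt (a j)) e)) ** cadj U ** D) \<bullet> D"
  proof (rule quadform_lower[OF U(1)])
    fix i
    have "sqrt (a i) \<le> B"
      using row_norm_le[OF U(1), of X i] assms(3) by (simp add: gram_eigenvalue[OF U])
    then show "inverse B \<le> inverse (max (sqrt (a i)) e)"
      using assms by (intro le_imp_inverse_le) auto
  qed
  then show ?thesis by (simp add: irls_weight_spectral[OF U] field_simps)
qed

lemma irls_weight_norm:
  assumes "0 < e"
  shows "norm (irls_weight X e ** D) \<le> norm D / e"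
proof -
  obtain U a where U: "unitary_mat U" "X ** cadj X = U ** diag_mat a ** cadj U"
    using gram_spectral by blast
  have "(norm (irls_weight X e ** D))\<^sup>2 \<le> (norm D / e)\<^sup>2"
    unfolding irls_weight_spectral[OF U] norm_sq_unitary_rows[OF U(1)] power_divide
      spectral_row[OF U(1)] sum_divide_distrib norm_scaleR power_mult_distrib
  proof (rule sum_mono)
    fix i
    have "\<bar>inverse (max (sqrt (a i)) e)\<bar> \<le> inverse e"
      using assms by (simp add: le_imp_inverse_le)
    then have "\<bar>inverse (max (sqrt (a i)) e)\<bar>\<^sup>2 \<le> (inverse e)\<^sup>2" by (intro power_mono) auto
    then show "\<bar>inverse (max (sqrt (a i)) e)\<bar>\<^sup>2 * (norm ((cadj U ** D) $ i))\<^sup>2 \<le> (norm ((cadj U ** D) $ i))\<^sup>2 / e\<^sup>2"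
      using mult_right_mono[of _ "(inverse e)\<^sup>2" "(norm ((cadj U ** D) $ i))\<^sup>2"]
      by (simp add: divide_inverse mult.commute power_inverse)
  qed
  then show ?thesis by (rule power2_le_imp_le) (use assms in simp)
qed

section \<open>Invariants, energy descent and boundedness of the iterates\<close>

locale irls =
  fixes S :: "complex^'p^'n \<Rightarrow> complex^'m" and M :: "complex^'m" and K :: nat and \<gamma> :: real
  assumes linear_S: "linear S" and surj_S: "surj S" and gamma_pos: "0 < \<gamma>"
begin

text \<open>\<open>X 0\<close> is the placeholder of the initial state; the iterates proper are
  \<open>X (Suc l)\<close>.\<close>

definition X where "X l = irls_X S M K \<gamma> l"
definition eps where "eps l = irls_eps S M K \<gamma> l"
definition W where "W l = snd (snd (irls_state S M K \<gamma> l))"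
definition J where "J l = J_eps (eps l) (X l)"

lemma eps_0: "eps 0 = 1"
  by (simp add: eps_def irls_eps_def)

lemma step_stop:
  assumes "eps l = 0"
  shows "X (Suc l) = X l" "eps (Suc l) = eps l" "W (Suc l) = W l"
  using assms by (auto simp: X_def eps_def W_def irls_X_def irls_eps_def split: prod.split)

lemma step_go:
  assumes "eps l \<noteq> 0"
  shows "X (Suc l) = arg_min (\<lambda>Y. (norm (psd_sqrt (W l) ** Y))\<^sup>2) (\<lambda>Y. S Y = M)"
    and "eps (Suc l) = min (eps l) (\<gamma> * sing_val (X (Suc l)) (K + 1))"
    and "W (Suc l) = irls_weight (X (Suc l)) (eps (Suc l))"
  using assms by (auto simp: X_def eps_def W_def irls_X_def irls_eps_def Let_def split: prod.split)

lemma eps_nonneg: "0 \<le> eps l"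
proof (induction l)
  case (Suc l)
  then show ?case
    using gamma_pos by (cases "eps l = 0") (auto simp: step_stop step_go sing_val_nonneg)
qed (simp add: eps_0)

lemma eps_Suc_le: "eps (Suc l) \<le> eps l"
  by (cases "eps l = 0") (auto simp: step_stop step_go)

lemma decseq_eps: "decseq eps"
  by (rule decseq_SucI) (rule eps_Suc_le)

lemma eps_le_1: "eps l \<le> 1"
  using decseqD[OF decseq_eps, of 0 l] by (simp add: eps_0)

text \<open>This persists after stopping: the step that reaches \<open>eps = 0\<close> still updates
  the weight, and from then on the state is frozen.\<close>

lemma W_Suc: "W (Suc l) = irls_weight (X (Suc l)) (eps (Suc l))"
proof (induction l)
  case 0
  then show ?case by (intro step_go) (simp add: eps_0)
next
  case (Suc l)
  then show ?case by (cases "eps (Suc l) = 0") (simp_all add: step_stop step_go)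
qed

lemma W_posdef:
  assumes "eps l \<noteq> 0"
  shows "\<exists>U w. unitary_mat U \<and> (\<forall>i. 0 < w i) \<and> W l = U ** diag_mat w ** cadj U"
proof (cases l)
  case 0
  have "W 0 = mat 1 ** diag_mat (\<lambda>_. 1) ** cadj (mat 1)" by (simp add: W_def diag_mat_one)
  then show ?thesis unfolding 0
    by (intro exI[of _ "mat 1"] exI[of _ "\<lambda>_. 1"]) (simp add: unitary_mat_def)
next
  case (Suc k)
  then show ?thesis
    using irls_weight_posdef[of "eps l" "X l"] assms eps_nonneg[of l] by (auto simp: W_Suc)
qed

lemma step_go_minimizer:
  assumes "eps l \<noteq> 0"
  shows "S (X (Suc l)) = M" "S H = 0 \<Longrightarrow> (W l ** X (Suc l)) \<bullet> H = 0"
proof -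
  obtain U w where U: "unitary_mat U" "\<And>i. 0 < w i" "W l = U ** diag_mat w ** cadj U"
    using W_posdef[OF assms] by blast
  obtain Y0 where Y0: "S Y0 = M" using surj_S by (metis surjD)
  note wls = weighted_least_squares[OF linear_S Y0 U step_go(1)[OF assms]]
  show "S (X (Suc l)) = M" "S H = 0 \<Longrightarrow> (W l ** X (Suc l)) \<bullet> H = 0"
    by (fact wls)+
qed

lemma feasible: "S (X (Suc l)) = M"
proof (induction l)
  case 0
  then show ?case by (rule step_go_minimizer) (simp add: eps_0)
next
  case (Suc l)
  then show ?case
    by (cases "eps (Suc l) = 0") (auto simp: step_stop intro: step_go_minimizer)
qed

lemma eps_le_sing_val: "eps (Suc l) \<le> \<gamma> * sing_val (X (Suc l)) (K + 1)"
proof (induction l)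
  case 0
  then show ?case using step_go(2)[of 0] eps_0 by simp
next
  case (Suc l)
  then show ?case
    by (cases "eps (Suc l) = 0") (auto simp: step_stop dest!: step_go(2))
qed

lemma eps_decrease:
  assumes "eps (Suc l) < eps l"
  shows "eps (Suc l) = \<gamma> * sing_val (X (Suc l)) (K + 1)"
proof -
  have "eps l \<noteq> 0" using assms eps_nonneg[of "Suc l"] by auto
  then show ?thesis using assms step_go(2)[of l] by (auto simp: min_def split: if_splits)
qed

text \<open>The value 0 is first reached by a strict decrease, where \<open>eps\<close> equals
  \<open>\<gamma>\<close> times the singular value; afterwards the state is frozen.\<close>

lemma eps_zero_sing_val: "eps l = 0 \<Longrightarrow> sing_val (X l) (K + 1) = 0"
proof (induction l)
  case 0
  then show ?case by (simp add: eps_0)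
next
  case (Suc l)
  show ?case
  proof (cases "eps l = 0")
    case True
    then show ?thesis using Suc.IH by (simp add: step_stop)
  next
    case False
    then have "eps (Suc l) < eps l" using Suc.prems eps_nonneg[of l] by simp
    then show ?thesis using eps_decrease[of l] Suc.prems gamma_pos by simp
  qed
qed

text \<open>Either \<open>eps\<close> has become 0, and the singular value vanishes too, or
  \<open>eps\<close> must still decrease strictly, since otherwise it would stay at a positive
  value. A strict decrease attains the singular value.\<close>

lemma eps_attained:
  assumes "eps \<longlonglongrightarrow> 0"
  shows "\<exists>l\<ge>N. \<gamma> * sing_val (X (Suc l)) (K + 1) = eps (Suc l)"
proof (cases "eps (Suc N) = 0")
  case True
  then show ?thesis using eps_zero_sing_val[OF True] by (intro exI[of _ N]) simp
next
  case False
  have "\<exists>l\<ge>N. eps (Suc l) < eps l"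
  proof (rule ccontr)
    assume "\<not> ?thesis"
    then have const: "eps (Suc l) = eps l" if "l \<ge> N" for l
      using that eps_Suc_le[of l] by (metis order_less_le)
    have "eps l = eps N" if "l \<ge> N" for l
      using that by (induction l rule: dec_induct) (auto simp: const)
    then have "\<forall>\<^sub>F l in sequentially. eps l = eps N"
      by (rule eventually_sequentiallyI)
    then have "eps \<longlonglongrightarrow> eps N" by (rule tendsto_eventually)
    then have "eps N = 0" using assms LIMSEQ_unique by blast
    then show False using const[of N] False by simp
  qed
  then show ?thesis using eps_decrease by metis
qed

text \<open>Lowering \<open>eps\<close> lowers the energy, and the quadratic majorant bounds the
  rest. Since the weighted new iterate is orthogonal to the step, a Pythagorean identity turns the
  change of the quadratic form into minus the weighted square of the step.\<close>

lemma J_descent: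
  "J (Suc (Suc l)) + ((W (Suc l) ** (X (Suc (Suc l)) - X (Suc l))) \<bullet> (X (Suc (Suc l)) - X (Suc l))) / 2
     \<le> J (Suc l)" if "eps (Suc l) \<noteq> 0"
proof -
  let ?X = "X (Suc l)" and ?X' = "X (Suc (Suc l))" and ?W = "W (Suc l)"
  have pos: "0 < eps (Suc l)" using that eps_nonneg[of "Suc l"] by simp
  have Wh: "cadj ?W = ?W" by (simp add: W_Suc irls_weight_hermitian)
  have "S (?X' - ?X) = 0" by (simp add: linear_diff[OF linear_S] feasible)
  from step_go_minimizer(2)[OF that this] have orth: "(?W ** ?X') \<bullet> ?X' = (?W ** ?X') \<bullet> ?X"
    by (simp add: inner_diff_right)
  have "J (Suc (Suc l)) \<le> J_eps (eps (Suc l)) ?X'"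
    unfolding J_def by (intro J_eps_mono eps_nonneg eps_Suc_le)
  also have "\<dots> \<le> J (Suc l) + ((?W ** ?X') \<bullet> ?X' - (?W ** ?X) \<bullet> ?X) / 2"
    unfolding J_def by (rule J_eps_descent[OF pos W_Suc])
  also have "(?W ** ?X') \<bullet> ?X' - (?W ** ?X) \<bullet> ?X = - ((?W ** (?X' - ?X)) \<bullet> (?X' - ?X))"
    using orth hermitian_inner[OF Wh, of ?X ?X']
    by (simp add: matrix_diff_ldistrib inner_diff_left inner_diff_right)
  finally show ?thesis by simp
qed

lemma J_Suc_le: "J (Suc (Suc l)) \<le> J (Suc l)"
proof (cases "eps (Suc l) = 0")
  case True
  then show ?thesis by (simp add: J_def step_stop)
next
  case False
  then have "0 < eps (Suc l)" using eps_nonneg[of "Suc l"] by simp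
  then obtain U w where U: "unitary_mat U" "\<And>i. 0 < w i" "W (Suc l) = U ** diag_mat w ** cadj U"
    using W_posdef[OF False] by blast
  have "0 \<le> (W (Suc l) ** D) \<bullet> D" for D :: "complex^'p^'n"
    using quadform_lower[of U 0 w D] U by (simp add: less_imp_le)
  then show ?thesis using J_descent[OF False] by (smt (verit) divide_nonneg_pos)
qed

lemma J_le_J1: "J (Suc l) \<le> J 1"
  by (induction l) (use J_Suc_le in \<open>auto intro: order_trans\<close>)

lemma nuclear_norm_le_J1: "nuclear_norm (X (Suc l)) \<le> J 1"
  using nuclear_norm_le_J[OF eps_nonneg, of "X (Suc l)" "Suc l"] J_le_J1[of l] by (simp add: J_def)

lemma bounded_X: "bounded (range (\<lambda>l. X (Suc l)))"
proof (rule boundedI)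
  fix Y assume "Y \<in> range (\<lambda>l. X (Suc l))"
  then obtain l where "Y = X (Suc l)" by blast
  then show "norm Y \<le> J 1" using norm_le_nuclear_norm nuclear_norm_le_J1 order_trans by metis
qed

lemma convergent_J: "convergent (\<lambda>l. J (Suc l))"
proof (rule Bseq_monoseq_convergent)
  show "monoseq (\<lambda>l. J (Suc l))"
    using J_Suc_le by (simp add: monoseq_Suc)
  have "0 \<le> J (Suc l)" for l
    unfolding J_def using nuclear_norm_le_J[OF eps_nonneg] nuclear_norm_nonneg order_trans by blast
  then show "Bseq (\<lambda>l. J (Suc l))"
    using J_le_J1 by (intro BseqI'[of _ "J 1"]) simp
qed

text \<open>On the bounded iterates the weights are uniformly bounded below, so the squared step is
  at most a constant times the decrease of the convergent sequence \<open>J\<close>.\<close>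

lemma X_diff_tendsto: "(\<lambda>l. X (Suc (Suc l)) - X (Suc l)) \<longlonglongrightarrow> 0"
proof -
  define B where "B = max 1 (J 1)"
  have B: "0 < B" by (simp add: B_def)
  have bound: "(norm (X (Suc (Suc l)) - X (Suc l)))\<^sup>2 \<le> 2 * B * (J (Suc l) - J (Suc (Suc l)))" for l
  proof (cases "eps (Suc l) = 0")
    case True
    then show ?thesis by (simp add: step_stop J_def)
  next
    case False
    let ?D = "X (Suc (Suc l)) - X (Suc l)"
    have "(norm ?D)\<^sup>2 / B \<le> (W (Suc l) ** ?D) \<bullet> ?D"
      unfolding W_Suc
    proof (rule irls_weight_lower)
      show "0 < eps (Suc l)" using False eps_nonneg[of "Suc l"] by simp
      show "eps (Suc l) \<le> B" using eps_le_1[of "Suc l"] by (simp add: B_def)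
      show "norm (X (Suc l)) \<le> B"
        using norm_le_nuclear_norm[of "X (Suc l)"] nuclear_norm_le_J1[of l] by (simp add: B_def)
    qed
    then have "(norm ?D)\<^sup>2 / B \<le> 2 * (J (Suc l) - J (Suc (Suc l)))"
    proof -
      have "a \<le> 2 * (j - j')" if "a \<le> w" "j' + w / 2 \<le> j" for a w j j' :: real
        using that by simp
      from this[OF _ J_descent[OF False]] show "(norm ?D)\<^sup>2 / B \<le> (W (Suc l) ** ?D) \<bullet> ?D \<Longrightarrow> ?thesis" .
    qed
    then show ?thesis using B by (simp only: pos_divide_le_eq mult_ac)
  qed
  have lim: "(\<lambda>l. 2 * B * (J (Suc l) - J (Suc (Suc l)))) \<longlonglongrightarrow> 0"
  proof -
    obtain L where L: "(\<lambda>l. J (Suc l)) \<longlonglongrightarrow> L" using convergent_J by (auto simp: convergent_def)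
    have "(\<lambda>l. 2 * B * (J (Suc l) - J (Suc (Suc l)))) \<longlonglongrightarrow> 2 * B * (L - L)"
      by (intro tendsto_intros L LIMSEQ_Suc[OF L])
    then show ?thesis by simp
  qed
  have "(\<lambda>l. (norm (X (Suc (Suc l)) - X (Suc l)))\<^sup>2) \<longlonglongrightarrow> 0"
    by (rule Lim_null_comparison[OF _ lim]) (use bound in simp)
  then have "(\<lambda>l. sqrt ((norm (X (Suc (Suc l)) - X (Suc l)))\<^sup>2)) \<longlonglongrightarrow> sqrt 0"
    by (rule tendsto_real_sqrt)
  then show ?thesis by (simp add: tendsto_norm_zero_iff)
qed

section \<open>Limits of subsequences and the convergence statements\<close>

lemma bounded_subseq:
  fixes r :: "nat \<Rightarrow> nat"
  shows "\<exists>s Y. strict_mono s \<and> (\<lambda>j. X (Suc (r (s j)))) \<longlonglongrightarrow> Y"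
proof -
  have "bounded (range (\<lambda>j. X (Suc (r j))))"
    by (rule bounded_subset[OF bounded_X]) auto
  then show ?thesis
    using bounded_imp_convergent_subsequence[of "\<lambda>j. X (Suc (r j))"] by (auto simp: o_def)
qed

lemma limit_feasible:
  assumes "(\<lambda>j. X (Suc (r j))) \<longlonglongrightarrow> Y"
  shows "S Y = M"
proof -
  have "(\<lambda>j. S (X (Suc (r j)))) \<longlonglongrightarrow> S Y"
    using assms by (rule bounded_linear.tendsto[OF linear_S[unfolded linear_conv_bounded_linear]])
  then show ?thesis by (simp add: feasible LIMSEQ_const_iff)
qed

lemma tendsto_nuclear_norm:
  fixes Z :: "nat \<Rightarrow> complex^'p^'n"
  assumes "Z \<longlonglongrightarrow> Y"
  shows "(\<lambda>j. nuclear_norm (Z j - Y)) \<longlonglongrightarrow> 0" "(\<lambda>j. nuclear_norm (Z j)) \<longlonglongrightarrow> nuclear_norm Y"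
proof -
  have h: "(\<lambda>j. real CARD('n) * norm (Z j - Y)) \<longlonglongrightarrow> real CARD('n) * norm (Y - Y)"
    by (intro tendsto_intros assms)
  show *: "(\<lambda>j. nuclear_norm (Z j - Y)) \<longlonglongrightarrow> 0"
  proof (rule tendsto_sandwich[OF _ _ tendsto_const])
    show "(\<lambda>j. real CARD('n) * norm (Z j - Y)) \<longlonglongrightarrow> 0" using h by simp
  qed (intro always_eventually allI nuclear_norm_nonneg nuclear_norm_le_norm)+
  have "norm (nuclear_norm (Z j) - nuclear_norm Y) \<le> nuclear_norm (Z j - Y)" for j
    using nuclear_norm_triangle_sub[of "Z j" Y] nuclear_norm_triangle_sub[of Y "Z j"]
    by (simp add: nuclear_norm_minus_commute[of Y] abs_le_iff)
  then have "(\<lambda>j. nuclear_norm (Z j) - nuclear_norm Y) \<longlonglongrightarrow> 0"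
    by (intro Lim_null_comparison[OF _ *]) auto
  then show "(\<lambda>j. nuclear_norm (Z j)) \<longlonglongrightarrow> nuclear_norm Y"
    by (simp add: LIM_zero_iff)
qed

lemma nuclear_norm_zero_tendsto:
  fixes Z :: "nat \<Rightarrow> complex^'p^'n"
  assumes "(\<lambda>j. nuclear_norm (Z j - Y)) \<longlonglongrightarrow> 0"
  shows "Z \<longlonglongrightarrow> Y"
proof -
  have "(\<lambda>j. Z j - Y) \<longlonglongrightarrow> 0"
    by (rule Lim_null_comparison[OF _ assms]) (simp add: norm_le_nuclear_norm)
  then show ?thesis by (simp add: LIM_zero_iff)
qed

theorem convergence_eps_zero:
  assumes srnsp: "srnsp S K \<eta>" and lim: "eps \<longlonglongrightarrow> 0"
  shows "\<exists>Xbar. (\<lambda>l. X (Suc l)) \<longlonglongrightarrow> Xbar \<and> rank Xbar \<le> K \<and> S Xbar = M \<and>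
    is_arg_min nuclear_norm (\<lambda>Z. S Z = M) Xbar \<and>
    (\<forall>Y. is_arg_min nuclear_norm (\<lambda>Z. S Z = M) Y \<longrightarrow> Y = Xbar)"
proof -
  have eta: "0 < \<eta>" "\<eta> < 1" using srnsp by (auto simp: srnsp_def)
  define C where "C = (1 + \<eta>) / (1 - \<eta>)"
  have C: "0 < C" using eta by (simp add: C_def)
  \<comment> \<open>Along these infinitely many indices the singular value at \<open>K + 1\<close>
    tends to 0 with \<open>eps\<close>, which bounds the rank of a limit.\<close>
  have "\<forall>N. \<exists>l. l > N \<and> \<gamma> * sing_val (X (Suc l)) (K + 1) = eps (Suc l)"
    using eps_attained[OF lim] by (meson Suc_le_lessD)
  then have "infinite {l. \<gamma> * sing_val (X (Suc l)) (K + 1) = eps (Suc l)}"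
    by (simp add: infinite_nat_iff_unbounded)
  from infinite_enumerate[OF this]
  obtain r :: "nat \<Rightarrow> nat" where r: "strict_mono r" "\<forall>j. \<gamma> * sing_val (X (Suc (r j))) (K + 1) = eps (Suc (r j))"
    by auto
  obtain s Xbar where s: "strict_mono s" "(\<lambda>j. X (Suc (r (s j)))) \<longlonglongrightarrow> Xbar"
    using bounded_subseq by blast
  have rs: "strict_mono (\<lambda>j. r (s j))" using r(1) s(1) by (simp add: strict_mono_def)
  have SX: "S Xbar = M" by (rule limit_feasible[OF s(2)])
  have rank: "rank Xbar \<le> K"
  proof (rule rank_limit_le[OF s(2)])
    have "(\<lambda>j. eps (Suc (r (s j))) / \<gamma>) \<longlonglongrightarrow> 0 / \<gamma>"
      using LIMSEQ_subseq_LIMSEQ[OF LIMSEQ_Suc[OF lim] rs] gamma_pos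
      by (intro tendsto_intros) (auto simp: o_def)
    moreover have "eps (Suc (r (s j))) / \<gamma> = sing_val (X (Suc (r (s j)))) (K + 1)" for j
      using spec[OF r(2), of "s j"] gamma_pos by (simp add: field_simps)
    ultimately show "(\<lambda>j. sing_val (X (Suc (r (s j)))) (K + 1)) \<longlonglongrightarrow> 0" by simp
  qed
  \<comment> \<open>The approximant in \<open>srnsp_distance_rank\<close> is \<open>Xbar\<close>
    itself, so the approximation error vanishes.\<close>
  have dist: "nuclear_norm (Y - Xbar) \<le> C * (nuclear_norm Y - nuclear_norm Xbar)" if "S Y = M" for Y
  proof -
    have "S (Y - Xbar) = 0" by (simp add: linear_diff[OF linear_S] that SX)
    from srnsp_distance_rank[OF srnsp this rank] show ?thesis by (simp add: C_def)
  qed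
  have min: "nuclear_norm Xbar \<le> nuclear_norm Y" if "S Y = M" for Y
    using dist[OF that] nuclear_norm_nonneg[of "Y - Xbar"] C by (smt (verit) zero_le_mult_iff)
  have uniq: "Y = Xbar" if "S Y = M" "nuclear_norm Y \<le> nuclear_norm Xbar" for Y
  proof -
    have "nuclear_norm (Y - Xbar) \<le> 0"
      using dist[OF that(1)] that(2) C by (smt (verit) mult_nonneg_nonpos)
    then show ?thesis using nuclear_norm_eq_0[of "Y - Xbar"] by simp
  qed
  \<comment> \<open>The gap between \<open>J\<close> and the nuclear norm is at most
    \<open>real CARD('n) * eps (Suc l) / 2\<close>, so the norms converge along the whole sequence;
    the subsequence identifies the limit. Then \<open>dist\<close> gives convergence of the
    iterates.\<close>
  have nn: "(\<lambda>l. nuclear_norm (X (Suc l))) \<longlonglongrightarrow> nuclear_norm Xbar"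
  proof -
    obtain L where L: "(\<lambda>l. J (Suc l)) \<longlonglongrightarrow> L" using convergent_J by (auto simp: convergent_def)
    have "norm (J (Suc l) - nuclear_norm (X (Suc l))) \<le> real CARD('n) * eps (Suc l) / 2" for l
      using nuclear_norm_le_J[OF eps_nonneg, of "X (Suc l)" "Suc l"]
        J_le_nuclear_norm[OF eps_nonneg, of "Suc l" "X (Suc l)"] by (simp add: J_def)
    then have "\<forall>\<^sub>F l in sequentially. norm (J (Suc l) - nuclear_norm (X (Suc l))) \<le> real CARD('n) * eps (Suc l) / 2"
      by (intro always_eventually allI)
    moreover have "(\<lambda>l. real CARD('n) * eps (Suc l) / 2) \<longlonglongrightarrow> 0"
      using LIMSEQ_Suc[OF lim] by (intro tendsto_divide_zero tendsto_mult_right_zero)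
    ultimately have "(\<lambda>l. J (Suc l) - nuclear_norm (X (Suc l))) \<longlonglongrightarrow> 0"
      by (rule Lim_null_comparison)
    from tendsto_diff[OF L this] have "(\<lambda>l. nuclear_norm (X (Suc l))) \<longlonglongrightarrow> L" by simp
    moreover from LIMSEQ_subseq_LIMSEQ[OF this rs] tendsto_nuclear_norm(2)[OF s(2)]
    have "L = nuclear_norm Xbar" by (auto simp: o_def intro: LIMSEQ_unique)
    ultimately show ?thesis by simp
  qed
  have "(\<lambda>l. nuclear_norm (X (Suc l) - Xbar)) \<longlonglongrightarrow> 0"
  proof (rule tendsto_sandwich[OF _ _ tendsto_const])
    show "(\<lambda>l. C * (nuclear_norm (X (Suc l)) - nuclear_norm Xbar)) \<longlonglongrightarrow> 0"
      using tendsto_mult[OF tendsto_const[of C] tendsto_diff[OF nn tendsto_const[of "nuclear_norm Xbar"]]] by simp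
  qed (auto simp: nuclear_norm_nonneg dist feasible)
  then have "(\<lambda>l. X (Suc l)) \<longlonglongrightarrow> Xbar" by (rule nuclear_norm_zero_tendsto)
  then show ?thesis using rank SX min uniq by (intro exI[of _ Xbar]) (auto simp: is_arg_min_linorder)
qed

text \<open>
  The subgradient \<open>W\<^sup>l X\<^sup>l\<close> of \<open>J_eps\<close> at \<open>X\<^sup>l\<close> differs by \<open>W\<^sup>l (X\<^sup>l - X\<^sup>l\<^sup>+\<^sup>1)\<close>, which tends to 0, from a
  matrix orthogonal to the kernel of \<open>S\<close>. The subgradient inequality at \<open>Xbar\<close> supplies the lower
  semicontinuity that is needed in the limit.
\<close>

theorem accumulation_minimizer:
  assumes e: "0 < e" and lim: "eps \<longlonglongrightarrow> e"
    and r: "strict_mono r" and conv: "(\<lambda>j. X (Suc (r j))) \<longlonglongrightarrow> Xbar"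
  shows "is_arg_min (J_eps e) (\<lambda>Z. S Z = M) Xbar"
proof -
  have eps_ge: "e \<le> eps l" for l by (rule decseq_ge[OF decseq_eps lim])
  have "J_eps e Xbar \<le> J_eps e Y" if Y: "S Y = M" for Y
  proof -
    define D where "D = irls_weight Xbar e ** Xbar"
    \<comment> \<open>\<open>g\<close> collects a lower bound with its error terms; along
      \<open>r\<close> all terms except \<open>J_eps e Xbar\<close> tend to 0.\<close>
    define g where "g l = J_eps e Xbar + D \<bullet> (X (Suc l) - Xbar)
      - norm (X (Suc (Suc l)) - X (Suc l)) / e * norm (Y - X (Suc l)) - real CARD('n) * (eps (Suc l) - e) / 2" for l
    have "g l \<le> J_eps e Y" for l
    proof -
      have pos: "0 < eps (Suc l)" using eps_ge[of "Suc l"] e by linarith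
      have "J_eps e Xbar + D \<bullet> (X (Suc l) - Xbar) \<le> J_eps e (X (Suc l))"
        unfolding D_def using e by (intro J_eps_subgradient) simp
      also have "\<dots> \<le> J (Suc l)"
        unfolding J_def using e eps_ge by (intro J_eps_mono) auto
      also have "\<dots> \<le> J_eps (eps (Suc l)) Y - (W (Suc l) ** X (Suc l)) \<bullet> (Y - X (Suc l))"
        unfolding J_def W_Suc using J_eps_subgradient[OF eps_nonneg, of "Suc l" "X (Suc l)" Y] by simp
      also have "J_eps (eps (Suc l)) Y \<le> J_eps e Y + real CARD('n) * (eps (Suc l) - e) / 2"
        using e eps_ge by (intro J_eps_lipschitz) auto
      also have "(W (Suc l) ** X (Suc l)) \<bullet> (Y - X (Suc l)) =
          - ((W (Suc l) ** (X (Suc (Suc l)) - X (Suc l))) \<bullet> (Y - X (Suc l)))"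
      proof -
        have "S (Y - X (Suc l)) = 0" by (simp add: linear_diff[OF linear_S] feasible Y)
        with step_go_minimizer(2)[of "Suc l" "Y - X (Suc l)"] pos
        show ?thesis by (simp add: matrix_diff_ldistrib inner_diff_left)
      qed
      finally have "J_eps e Xbar + D \<bullet> (X (Suc l) - Xbar) \<le> J_eps e Y + real CARD('n) * (eps (Suc l) - e) / 2
          + (W (Suc l) ** (X (Suc (Suc l)) - X (Suc l))) \<bullet> (Y - X (Suc l))" by simp
      also have "(W (Suc l) ** (X (Suc (Suc l)) - X (Suc l))) \<bullet> (Y - X (Suc l)) \<le>
          norm (W (Suc l) ** (X (Suc (Suc l)) - X (Suc l))) * norm (Y - X (Suc l))"
        by (rule norm_cauchy_schwarz)
      also have "\<dots> \<le> norm (X (Suc (Suc l)) - X (Suc l)) / e * norm (Y - X (Suc l))"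
      proof (rule mult_right_mono)
        have "norm (W (Suc l) ** (X (Suc (Suc l)) - X (Suc l))) \<le> norm (X (Suc (Suc l)) - X (Suc l)) / eps (Suc l)"
          unfolding W_Suc by (rule irls_weight_norm[OF pos])
        also have "\<dots> \<le> norm (X (Suc (Suc l)) - X (Suc l)) / e"
          using e eps_ge mult_pos_pos[OF pos e] by (intro divide_left_mono) auto
        finally show "norm (W (Suc l) ** (X (Suc (Suc l)) - X (Suc l))) \<le> norm (X (Suc (Suc l)) - X (Suc l)) / e" .
      qed simp
      finally show ?thesis by (simp add: g_def)
    qed
    moreover have "(\<lambda>j. g (r j)) \<longlonglongrightarrow> J_eps e Xbar + D \<bullet> (Xbar - Xbar)
      - norm (0 :: complex^'p^'n) / e * norm (Y - Xbar) - real CARD('n) * (e - e) / 2"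
      unfolding g_def
      using LIMSEQ_subseq_LIMSEQ[OF X_diff_tendsto r] LIMSEQ_subseq_LIMSEQ[OF LIMSEQ_Suc[OF lim] r] e
      by (intro tendsto_intros conv) (auto simp: o_def)
    ultimately show ?thesis
      by (intro LIMSEQ_le_const2[of "\<lambda>j. g (r j)"]) auto
  qed
  then show ?thesis using limit_feasible[OF conv] by (auto simp: is_arg_min_linorder)
qed

text \<open>The choice of \<open>\<gamma>\<close> bounds \<open>real CARD('n) * eps\<close> by the
  singular value at \<open>K + 1\<close>. Multiplied by \<open>K + 1 - k\<close>, this is at most
  the best rank error of the iterate, which exceeds that of \<open>Y\<close> by at most their
  distance. The limit is taken along \<open>r\<close>.\<close>

lemma eps_limit_bound:
  assumes \<gamma>: "\<gamma> = 1 / real CARD('n)" and lim: "eps \<longlonglongrightarrow> e" and k: "k \<le> K"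
    and r: "strict_mono r" and conv: "(\<lambda>j. X (Suc (r j))) \<longlonglongrightarrow> Xbar"
  shows "(real K + 1 - real k) * (real CARD('n) * e) \<le> nuclear_norm (Y - Xbar) + best_rank_error k Y"
proof -
  have "(real K + 1 - real k) * (real CARD('n) * eps (Suc (r j))) \<le>
      nuclear_norm (X (Suc (r j)) - Xbar) + (nuclear_norm (Y - Xbar) + best_rank_error k Y)" for j
  proof -
    have "real CARD('n) * eps (Suc (r j)) \<le> sing_val (X (Suc (r j))) (K + 1)"
      using eps_le_sing_val[of "r j"] by (simp add: \<gamma> field_simps)
    then have "(real K + 1 - real k) * (real CARD('n) * eps (Suc (r j))) \<le>
        (real K + 1 - real k) * sing_val (X (Suc (r j))) (K + 1)"
      using k by (intro mult_left_mono) auto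
    also have "\<dots> = real (K + 1 - k) * sing_val (X (Suc (r j))) (K + 1)"
      using k by (simp add: of_nat_diff)
    also have "\<dots> \<le> best_rank_error k (X (Suc (r j)))"
      using k by (intro sing_val_le_best_rank_error) simp
    also have "\<dots> \<le> nuclear_norm (X (Suc (r j)) - Y) + best_rank_error k Y"
      by (rule best_rank_error_triangle)
    also have "nuclear_norm (X (Suc (r j)) - Y) \<le> nuclear_norm (X (Suc (r j)) - Xbar) + nuclear_norm (Y - Xbar)"
      using nuclear_norm_triangle_diff[of "X (Suc (r j))" Y Xbar] by (simp add: nuclear_norm_minus_commute)
    finally show ?thesis by simp
  qed
  moreover have "(\<lambda>j. (real K + 1 - real k) * (real CARD('n) * eps (Suc (r j)))) \<longlonglongrightarrow>
      (real K + 1 - real k) * (real CARD('n) * e)"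
    using LIMSEQ_subseq_LIMSEQ[OF LIMSEQ_Suc[OF lim] r] by (intro tendsto_intros) (auto simp: o_def)
  moreover have "(\<lambda>j. nuclear_norm (X (Suc (r j)) - Xbar) + (nuclear_norm (Y - Xbar) + best_rank_error k Y)) \<longlonglongrightarrow>
      0 + (nuclear_norm (Y - Xbar) + best_rank_error k Y)"
    by (intro tendsto_intros tendsto_nuclear_norm(1) conv)
  ultimately show ?thesis
    using LIMSEQ_le[of _ "(real K + 1 - real k) * (real CARD('n) * e)" _
        "0 + (nuclear_norm (Y - Xbar) + best_rank_error k Y)"] by auto
qed

text \<open>The null space property gives
  \<open>d * (1 - \<eta>) \<le> (1 + \<eta>) * (t + 2 * \<rho>)\<close>, and
  \<open>eps_limit_bound\<close> gives \<open>(real K + 1 - real k) * t \<le> d + \<rho>\<close>.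
  Eliminating \<open>d\<close> yields the first claim; its bound on \<open>t\<close>, put back into
  the first inequality, yields the second.\<close>

theorem accumulation_error:
  assumes \<gamma>: "\<gamma> = 1 / real CARD('n)" and e: "0 < e" and lim: "eps \<longlonglongrightarrow> e"
    and r: "strict_mono r" and conv: "(\<lambda>j. X (Suc (r j))) \<longlonglongrightarrow> Xbar"
    and srnsp: "srnsp S K \<eta>" and Y: "S Y = M" and k: "real k < real K - 2 * \<eta> / (1 - \<eta>)"
  shows "real CARD('n) * e * ((real K - real k) * (1 - \<eta>) - 2 * \<eta>) \<le> (3 + \<eta>) * best_rank_error k Y"
    and "nuclear_norm (Y - Xbar) \<le>
      (4 * (1 + \<eta>)\<^sup>2 / ((1 - \<eta>)\<^sup>2 * ((real K - real k) * (1 - \<eta>) - 2 * \<eta>))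
        + 2 * (1 + \<eta>) / (1 - \<eta>)) * best_rank_error k Y"
proof -
  define \<rho> where "\<rho> = best_rank_error k Y"
  define t where "t = real CARD('n) * e"
  define d where "d = nuclear_norm (Y - Xbar)"
  define D where "D = (real K - real k) * (1 - \<eta>) - 2 * \<eta>"
  have eta: "0 < \<eta>" "\<eta> < 1" using srnsp by (auto simp: srnsp_def)
  have rho: "0 \<le> \<rho>" unfolding \<rho>_def by (rule best_rank_error_nonneg)
  have "2 * \<eta> / (1 - \<eta>) < real K - real k" using k by simp
  then have D: "0 < D" using eta by (simp add: D_def divide_less_eq)
  have "0 \<le> 2 * \<eta> / (1 - \<eta>)" using eta by simp
  then have kK: "k \<le> K" using k by linarith
  have t: "0 \<le> t" using e by (simp add: t_def)
  have min: "is_arg_min (J_eps e) (\<lambda>Z. S Z = M) Xbar"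
    by (rule accumulation_minimizer[OF e lim r conv])
  have "nuclear_norm Xbar \<le> J_eps e Xbar" using e by (intro nuclear_norm_le_J) simp
  also have "\<dots> \<le> J_eps e Y" using min Y by (simp add: is_arg_min_linorder)
  also have "\<dots> \<le> nuclear_norm Y + t / 2" unfolding t_def using e by (intro J_le_nuclear_norm) simp
  finally have "nuclear_norm Xbar - nuclear_norm Y + 2 * \<rho> \<le> t + 2 * \<rho>"
    using t by simp
  moreover have "d \<le> (1 + \<eta>) / (1 - \<eta>) * (nuclear_norm Xbar - nuclear_norm Y + 2 * \<rho>)"
  proof -
    have "S (Xbar - Y) = 0"
      using limit_feasible[OF conv] Y by (simp add: linear_diff[OF linear_S])
    from srnsp_distance[OF srnsp this kK] show ?thesis
      by (simp add: d_def \<rho>_def nuclear_norm_minus_commute[of Y])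
  qed
  moreover have "0 \<le> (1 + \<eta>) / (1 - \<eta>)" using eta by simp
  ultimately have d: "d \<le> (1 + \<eta>) / (1 - \<eta>) * (t + 2 * \<rho>)"
    by (meson mult_left_mono order_trans)
  then have d': "d * (1 - \<eta>) \<le> (1 + \<eta>) * (t + 2 * \<rho>)" using eta by (simp add: field_simps)
  have "(real K + 1 - real k) * t \<le> d + \<rho>"
    unfolding t_def d_def \<rho>_def by (rule eps_limit_bound[OF \<gamma> lim kK r conv])
  then have "(1 - \<eta>) * ((real K + 1 - real k) * t) \<le> (1 - \<eta>) * (d + \<rho>)"
    using eta by (intro mult_left_mono) auto
  with d' show *: "real CARD('n) * e * ((real K - real k) * (1 - \<eta>) - 2 * \<eta>) \<le> (3 + \<eta>) * best_rank_error k Y"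
    unfolding t_def[symmetric] \<rho>_def[symmetric] by (simp add: algebra_simps)
  then have "t * D \<le> (3 + \<eta>) * \<rho>" by (simp add: t_def D_def \<rho>_def)
  \<comment> \<open>The factor \<open>3 + \<eta>\<close> is enlarged to reach the stated
    constant.\<close>
  also have "\<dots> \<le> 4 * (1 + \<eta>) / (1 - \<eta>) * \<rho>"
  proof (rule mult_right_mono[OF _ rho])
    have "(3 + \<eta>) * (1 - \<eta>) \<le> 4 * (1 + \<eta>)" using eta by (simp add: algebra_simps)
    then show "3 + \<eta> \<le> 4 * (1 + \<eta>) / (1 - \<eta>)" using eta by (simp add: field_simps)
  qed
  finally have "t \<le> 4 * (1 + \<eta>) / (1 - \<eta>) * \<rho> / D" using D by (simp only: pos_le_divide_eq)
  then have "(1 + \<eta>) / (1 - \<eta>) * (t + 2 * \<rho>) \<le>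
      (1 + \<eta>) / (1 - \<eta>) * (4 * (1 + \<eta>) / (1 - \<eta>) * \<rho> / D + 2 * \<rho>)"
    using eta by (intro mult_left_mono) auto
  also have "\<dots> = (4 * (1 + \<eta>)\<^sup>2 / ((1 - \<eta>)\<^sup>2 * D) + 2 * (1 + \<eta>) / (1 - \<eta>)) * \<rho>"
  proof -
    have "b / a * (4 * b / a * \<rho> / D + 2 * \<rho>) = (4 * b\<^sup>2 / (a\<^sup>2 * D) + 2 * b / a) * \<rho>" for a b :: real
      by (simp add: power2_eq_square distrib_left distrib_right mult_ac)
    then show ?thesis .
  qed
  finally have "d \<le> (4 * (1 + \<eta>)\<^sup>2 / ((1 - \<eta>)\<^sup>2 * D) + 2 * (1 + \<eta>) / (1 - \<eta>)) * \<rho>"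
    using d by linarith
  then show "nuclear_norm (Y - Xbar) \<le>
      (4 * (1 + \<eta>)\<^sup>2 / ((1 - \<eta>)\<^sup>2 * ((real K - real k) * (1 - \<eta>) - 2 * \<eta>))
        + 2 * (1 + \<eta>) / (1 - \<eta>)) * best_rank_error k Y"
    by (simp add: d_def D_def \<rho>_def)
qed

text \<open>The best rank error of \<open>Y\<close> is 0, so a positive limit \<open>e\<close> would
  make the left side of the first estimate in \<open>accumulation_error\<close> positive and the
  right side at most 0.\<close>

theorem eps_tendsto_zero:
  assumes \<gamma>: "\<gamma> = 1 / real CARD('n)" and srnsp: "srnsp S K \<eta>"
    and k: "real k < real K - 2 * \<eta> / (1 - \<eta>)" and Y: "rank Y \<le> k" "S Y = M"
  shows "eps \<longlonglongrightarrow> 0"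
proof -
  obtain e where e: "eps \<longlonglongrightarrow> e" "\<And>l. e \<le> eps l"
    using decseq_convergent[OF decseq_eps, of 0] eps_nonneg by metis
  have "0 \<le> e" using LIMSEQ_le_const[OF e(1)] eps_nonneg by blast
  moreover have "\<not> 0 < e"
  proof
    assume pos: "0 < e"
    obtain s Xbar where s: "strict_mono s" "(\<lambda>j. X (Suc (s j))) \<longlonglongrightarrow> Xbar"
      using bounded_subseq[of "\<lambda>j. j"] by blast
    have "best_rank_error k Y \<le> 0" using best_rank_error_le[OF Y(1), of Y] by simp
    moreover have eta: "0 < \<eta>" "\<eta> < 1" using srnsp by (auto simp: srnsp_def)
    ultimately have "(3 + \<eta>) * best_rank_error k Y \<le> 0" by (simp add: mult_nonneg_nonpos)
    with accumulation_error(1)[OF \<gamma> pos e(1) s srnsp Y(2) k]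
    have "real CARD('n) * e * ((real K - real k) * (1 - \<eta>) - 2 * \<eta>) \<le> 0" by linarith
    moreover have "0 < (real K - real k) * (1 - \<eta>) - 2 * \<eta>"
    proof -
      have "2 * \<eta> / (1 - \<eta>) < real K - real k" using k by simp
      then show ?thesis using eta by (simp add: divide_less_eq)
    qed
    ultimately show False using pos by (simp add: mult_le_0_iff)
  qed
  ultimately show ?thesis using e(1) by simp
qed

end

section \<open>Transfer from the locale to the stated sequences\<close>

lemma complex_linear_imp_linear:
  fixes S :: "complex^'p^'n \<Rightarrow> complex^'m"
  assumes "Vector_Spaces.linear cscale (*s) S"
  shows "linear S"
proof -
  interpret S: Vector_Spaces.linear cscale "(*s)" S by (rule assms)
  show ?thesis
  proof (rule linearI)
    show "S (r *\<^sub>R Y) = r *\<^sub>R S Y" for r Y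
    proof -
      have "r *\<^sub>R Y = cscale (complex_of_real r) Y"
        by (simp add: vec_eq_iff cscale_def scaleR_conv_of_real[where 'a=complex])
      then have "S (r *\<^sub>R Y) = complex_of_real r *s S Y" by (simp add: S.scale)
      then show ?thesis by (simp add: vec_eq_iff scaleR_conv_of_real[where 'a=complex])
    qed
  qed (rule S.add)
qed

text \<open>Otherwise a subsequence keeps a distance \<open>\<delta>\<close> from \<open>L\<close>;
  compactness gives it an accumulation point, which would have to be \<open>L\<close>.\<close>

lemma bounded_unique_accumulation_tendsto:
  fixes x :: "nat \<Rightarrow> 'a::heine_borel"
  assumes bdd: "bounded (range x)" and uniq: "\<And>y. accumulation_point x y \<Longrightarrow> y = L"
  shows "x \<longlonglongrightarrow> L"
proof (rule ccontr)
  assume "\<not> x \<longlonglongrightarrow> L"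
  then obtain \<delta> where d: "\<delta> > 0" "\<exists>\<^sub>F n in sequentially. \<delta> \<le> dist (x n) L"
    unfolding tendsto_iff by (auto simp: not_eventually not_less)
  then have "infinite {n. \<delta> \<le> dist (x n) L}" by (simp add: frequently_cofinite[symmetric] cofinite_eq_sequentially)
  from infinite_enumerate[OF this] obtain r :: "nat \<Rightarrow> nat" where r: "strict_mono r" "\<forall>n. \<delta> \<le> dist (x (r n)) L" by auto
  have "bounded (range (x \<circ> r))" by (rule bounded_subset[OF bdd]) auto
  from bounded_imp_convergent_subsequence[OF this] obtain l s where s: "strict_mono s" "((x \<circ> r) \<circ> s) \<longlonglongrightarrow> l"
    by auto
  have "accumulation_point x l"
    unfolding accumulation_point_def
    using strict_mono_o[OF r(1) s(1)] s(2) by (intro exI[of _ "r \<circ> s"]) (simp add: o_assoc)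
  then have "l = L" by (rule uniq)
  have "(\<lambda>n. dist (x (r (s n))) L) \<longlonglongrightarrow> dist l L"
    using s(2) by (intro tendsto_intros) (simp add: o_def)
  then have "\<delta> \<le> dist l L" by (rule LIMSEQ_le_const) (use r(2) in auto)
  then show False using d(1) \<open>l = L\<close> by simp
qed

theorem theorem6p11:
  fixes S :: "complex^'p^'n \<Rightarrow> complex^'m" and M :: "complex^'m" and K :: nat
    and X :: "nat \<Rightarrow> complex^'p^'n" and eps :: "nat \<Rightarrow> real"
  assumes np: "CARD('n) \<le> CARD('p)"
    and lin: "Vector_Spaces.linear cscale (*s) S"
    and surj: "surj S"
    and X: "X = (\<lambda>l. irls_X S M K (1 / real CARD('n)) (Suc l))"
    and eps: "eps = irls_eps S M K (1 / real CARD('n))"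
  shows
    "((\<exists>\<eta>. srnsp S K \<eta>) \<longrightarrow> eps \<longlonglongrightarrow> 0 \<longrightarrow>
        (\<exists>Xbar. X \<longlonglongrightarrow> Xbar \<and> rank Xbar \<le> K \<and> S Xbar = M \<and>
           is_arg_min nuclear_norm (\<lambda>Z. S Z = M) Xbar \<and>
           (\<forall>Y. is_arg_min nuclear_norm (\<lambda>Z. S Z = M) Y \<longrightarrow> Y = Xbar)))
     \<and>
     (\<forall>e>0. eps \<longlonglongrightarrow> e \<longrightarrow>
        (\<forall>r::nat \<Rightarrow> nat. strict_mono r \<longrightarrow>
           (\<exists>(s::nat \<Rightarrow> nat) Y. strict_mono s \<and> (X \<circ> r \<circ> s) \<longlonglongrightarrow> Y)) \<and>
        (\<forall>Xbar. accumulation_point X Xbar \<longrightarrow> is_arg_min (J_eps e) (\<lambda>Z. S Z = M) Xbar) \<and>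
        (\<forall>Xbar. is_arg_min (J_eps e) (\<lambda>Z. S Z = M) Xbar \<and>
           (\<forall>Y. is_arg_min (J_eps e) (\<lambda>Z. S Z = M) Y \<longrightarrow> Y = Xbar) \<longrightarrow> X \<longlonglongrightarrow> Xbar) \<and>
        (\<forall>\<eta>. K > 2 \<longrightarrow> srnsp S K \<eta> \<longrightarrow> \<eta> < 1 - 2 / (real K - 2) \<longrightarrow>
           (\<forall>Xbar. accumulation_point X Xbar \<longrightarrow>
              (\<forall>Y k. S Y = M \<longrightarrow> real k < real K - 2 * \<eta> / (1 - \<eta>) \<longrightarrow>
                 nuclear_norm (Y - Xbar) \<le>
                   (4 * (1 + \<eta>)\<^sup>2 / ((1 - \<eta>)\<^sup>2 * ((real K - real k) * (1 - \<eta>) - 2 * \<eta>))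
                      + 2 * (1 + \<eta>) / (1 - \<eta>)) * best_rank_error k Y))))
     \<and>
     (\<forall>\<eta> k. K > 2 \<longrightarrow> srnsp S K \<eta> \<longrightarrow> \<eta> < 1 - 2 / (real K - 2) \<longrightarrow>
        real k < real K - 2 * \<eta> / (1 - \<eta>) \<longrightarrow> (\<exists>Y. rank Y \<le> k \<and> S Y = M) \<longrightarrow>
        eps \<longlonglongrightarrow> 0)"
proof -
  interpret I: irls S M K "1 / real CARD('n)"
    by (rule irls.intro) (auto simp: complex_linear_imp_linear[OF lin] surj)
  \<comment> \<open>The sequence \<open>X\<close> starts with the first iterate, so it is a shift by
    one, whereas \<open>eps\<close> is not shifted.\<close>
  have X_eq: "X = (\<lambda>l. I.X (Suc l))" by (simp add: X I.X_def fun_eq_iff)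
  have eps_eq: "eps = I.eps" by (simp add: eps I.eps_def fun_eq_iff)
  have minimizer: "is_arg_min (J_eps e) (\<lambda>Z. S Z = M) Xbar"
    if "0 < e" "eps \<longlonglongrightarrow> e" "accumulation_point X Xbar" for e Xbar
    using that I.accumulation_minimizer unfolding accumulation_point_def X_eq eps_eq o_def by blast
  show ?thesis
  proof (intro conjI allI impI)
    assume "\<exists>\<eta>. srnsp S K \<eta>" "eps \<longlonglongrightarrow> 0"
    then show "\<exists>Xbar. X \<longlonglongrightarrow> Xbar \<and> rank Xbar \<le> K \<and> S Xbar = M \<and>
           is_arg_min nuclear_norm (\<lambda>Z. S Z = M) Xbar \<and>
           (\<forall>Y. is_arg_min nuclear_norm (\<lambda>Z. S Z = M) Y \<longrightarrow> Y = Xbar)"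
      unfolding X_eq eps_eq using I.convergence_eps_zero by blast
  next
    fix r :: "nat \<Rightarrow> nat"
    show "\<exists>s Y. strict_mono s \<and> (X \<circ> r \<circ> s) \<longlonglongrightarrow> Y"
      using I.bounded_subseq[of r] by (simp add: X_eq o_def)
  next
    fix e Xbar assume "0 < e" "eps \<longlonglongrightarrow> e" "accumulation_point X Xbar"
    then show "is_arg_min (J_eps e) (\<lambda>Z. S Z = M) Xbar" by (rule minimizer)
  next
    fix e Xbar assume e: "0 < e" "eps \<longlonglongrightarrow> e" and "is_arg_min (J_eps e) (\<lambda>Z. S Z = M) Xbar \<and>
      (\<forall>Y. is_arg_min (J_eps e) (\<lambda>Z. S Z = M) Y \<longrightarrow> Y = Xbar)"
    then show "X \<longlonglongrightarrow> Xbar"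
      using minimizer[OF e] I.bounded_X
      by (intro bounded_unique_accumulation_tendsto) (auto simp: X_eq)
  next
    fix e \<eta> Xbar Y k
    assume "0 < e" "eps \<longlonglongrightarrow> e" "srnsp S K \<eta>" "accumulation_point X Xbar" "S Y = M"
      "real k < real K - 2 * \<eta> / (1 - \<eta>)"
    then show "nuclear_norm (Y - Xbar) \<le>
        (4 * (1 + \<eta>)\<^sup>2 / ((1 - \<eta>)\<^sup>2 * ((real K - real k) * (1 - \<eta>) - 2 * \<eta>))
          + 2 * (1 + \<eta>) / (1 - \<eta>)) * best_rank_error k Y"
      using I.accumulation_error(2)[OF refl] unfolding accumulation_point_def X_eq eps_eq o_def by blast
  next
    fix \<eta> k
    assume "srnsp S K \<eta>" "real k < real K - 2 * \<eta> / (1 - \<eta>)" "\<exists>Y. rank Y \<le> k \<and> S Y = M"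
    then show "eps \<longlonglongrightarrow> 0"
      unfolding eps_eq using I.eps_tendsto_zero[OF refl] by blast
  qed
qed

end
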